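(* Let $k>\ell$ be positive integers and let $A$ be a $(k,\ell)$-sum-free set of positive integers. Then $\widetilde{d}(A)\le\frac{1}{k+\ell}$.
   Context: A set $S$ of positive integers is $(k,\ell)$-sum-free if for all (not necessarily distinct) $x_1,\dots,x_k,y_1,\dots,y_\ell\in S$ one has $x_1+\dots+x_k\neq y_1+\dots+y_\ell$. For $A\subseteq\mathbb{Z}_{>0}$, the upper density on multiples is $\widetilde{d}(A)=\limsup_{N\to\infty}\limsup_{n\to\infty}\frac{|A\cap (N!\cdot[n])|}{n}$, where $[n]=\{1,\dots,n\}$ and $N!\cdot[n]=\{N!\,j: j\in[n]\}$. *)

theory Defs
  imports Complex_Main "HOL-Library.Extended_Real" "HOL-Library.Liminf_Limsup"
begin

definition sum_free :: "nat \<Rightarrow> nat \<Rightarrow> nat set \<Rightarrow> bool" where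
  "sum_free k l S \<longleftrightarrow>
     (\<forall>x y. (\<forall>i<k. x i \<in> S) \<and> (\<forall>j<l. y j \<in> S) \<longrightarrow> (\<Sum>i<k. x i) \<noteq> (\<Sum>j<l. y j))"

(* The limsups are taken in the extended reals, where they always exist; the quotients
   lie in [0, 1], so the value is that of the real limsup. The term n = 0 (0 / 0 = 0)
   does not affect the limsup. *)
definition upper_density_on_multiples :: "nat set \<Rightarrow> ereal" where
  "upper_density_on_multiples A =
     limsup (\<lambda>N. limsup (\<lambda>n. ereal (real (card (A \<inter> (\<lambda>j. fact N * j) ` {1..n})) / real n)))"

end

theory Submission
  imports Defs "HOL-Analysis.Function_Topology"
begin

text \<open>Sequences of rationals that are eventually divisible by every positive integer form a divisible
  group, and a limit of the sets of sequences whose \<open>N\<close>-th term lies in \<open>A\<close> is a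
  \<open>(k, l)\<close>-sum-free subset \<open>A'\<close> of this group. If the upper density of \<open>A\<close> on multiples exceeds
  \<open>\<delta>\<close>, then every finite subset of the group has a translate at least a proportion \<open>\<delta>\<close> of which
  lies in \<open>A'\<close>.

  In a divisible abelian group such a set has \<open>\<mu>(A') \<ge> \<delta>\<close> for some extreme invariant mean \<open>\<mu>\<close>, and there
  is a Kneser-type inequality without periodic exceptions, \<open>\<mu>(X + A') \<ge> min(1, \<mu>(X) + \<delta>)\<close> whenever
  \<open>\<mu>(X) > 0\<close>. It is proved by maximising the sum of the means of \<open>X\<close> and \<open>Z\<close> over all pairs with
  \<open>(Z - X) \<inter> A' = \<emptyset>\<close>, using the transforms that replace one of the sets by its union and the other
  by its intersection with a translate of itself. Consequently the disjoint sets \<open>kA'\<close> and \<open>lA'\<close>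
  have means at least \<open>min(1, k\<delta>)\<close> and \<open>min(1, l\<delta>)\<close>, so that \<open>(k + l)\<delta> \<le> 1\<close>.\<close>

section \<open>Means on abelian groups\<close>

text \<open>A finitely additive probability on all subsets, kept as a bare function so that the
  space of means inherits the product topology.\<close>

definition mean :: "('a set \<Rightarrow> real) \<Rightarrow> bool" where
  "mean \<mu> \<longleftrightarrow> (\<forall>E. 0 \<le> \<mu> E) \<and> \<mu> UNIV = 1 \<and> (\<forall>E F. E \<inter> F = {} \<longrightarrow> \<mu> (E \<union> F) = \<mu> E + \<mu> F)"

lemma mean_nonneg: "mean \<mu> \<Longrightarrow> 0 \<le> \<mu> E"
  and mean_UNIV: "mean \<mu> \<Longrightarrow> \<mu> UNIV = 1"
  and mean_disjoint: "mean \<mu> \<Longrightarrow> E \<inter> F = {} \<Longrightarrow> \<mu> (E \<union> F) = \<mu> E + \<mu> F"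
  by (auto simp: mean_def)

lemma mean_empty: "mean \<mu> \<Longrightarrow> \<mu> {} = 0"
  using mean_disjoint[of \<mu> "{}" "{}"] by simp

lemma mean_split:
  assumes "mean \<mu>"
  shows "\<mu> E = \<mu> (E \<inter> F) + \<mu> (E - F)"
  using mean_disjoint[OF assms, of "E \<inter> F" "E - F"] by (simp add: Int_Diff_Un Int_Diff_disjoint)

lemma mean_mono: "mean \<mu> \<Longrightarrow> E \<subseteq> F \<Longrightarrow> \<mu> E \<le> \<mu> F"
  using mean_split[of \<mu> F E] mean_nonneg[of \<mu> "F - E"] by (simp add: Int_absorb1)

lemma mean_le_1: "mean \<mu> \<Longrightarrow> \<mu> E \<le> 1"
  using mean_mono[of \<mu> E UNIV] by (simp add: mean_UNIV)

lemma mean_Compl: "mean \<mu> \<Longrightarrow> \<mu> (- E) = 1 - \<mu> E"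
  using mean_split[of \<mu> UNIV E] by (simp add: mean_UNIV Compl_eq_Diff_UNIV)

lemma mean_Un: "mean \<mu> \<Longrightarrow> \<mu> (E \<union> F) = \<mu> E + \<mu> (F - E)"
  using mean_disjoint[of \<mu> E "F - E"] by simp

lemma mean_disjoint_le_1: "mean \<mu> \<Longrightarrow> E \<inter> F = {} \<Longrightarrow> \<mu> E + \<mu> F \<le> 1"
  using mean_disjoint[of \<mu> E F] mean_le_1[of \<mu> "E \<union> F"] by simp

text \<open>Sets with null pairwise overlaps are disjoint up to null sets, so their means add up.
  The induction also carries that every later set meets the union so far in a null set.\<close>

lemma mean_null_overlaps:
  fixes E :: "nat \<Rightarrow> 'a set"
  assumes m: "mean \<mu>" and null: "\<And>i j. i < j \<Longrightarrow> j < n \<Longrightarrow> \<mu> (E i \<inter> E j) = 0"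
  shows "(\<Sum>i<n. \<mu> (E i)) \<le> 1"
proof -
  have "(\<Sum>i<k. \<mu> (E i)) = \<mu> (\<Union>i<k. E i) \<and> (\<forall>j\<ge>k. j < n \<longrightarrow> \<mu> (E j \<inter> (\<Union>i<k. E i)) = 0)"
    if "k \<le> n" for k
    using that
  proof (induction k)
    case 0
    then show ?case by (simp add: mean_empty[OF m])
  next
    case (Suc k)
    then have IH: "(\<Sum>i<k. \<mu> (E i)) = \<mu> (\<Union>i<k. E i)"
      "\<And>j. k \<le> j \<Longrightarrow> j < n \<Longrightarrow> \<mu> (E j \<inter> (\<Union>i<k. E i)) = 0" by auto
    have eq: "(\<Union>i<Suc k. E i) = (\<Union>i<k. E i) \<union> E k"
      by (auto simp: lessThan_Suc)
    have "\<mu> (E k) = \<mu> (E k - (\<Union>i<k. E i))"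
      using mean_split[OF m, of "E k" "\<Union>i<k. E i"] IH(2)[of k] Suc.prems(1) by simp
    then have 1: "(\<Sum>i<Suc k. \<mu> (E i)) = \<mu> (\<Union>i<Suc k. E i)"
      unfolding eq mean_Un[OF m] using IH(1) by simp
    have "\<mu> (E j \<inter> (\<Union>i<Suc k. E i)) = 0" if j: "Suc k \<le> j" "j < n" for j
    proof -
      have "\<mu> (E j \<inter> (\<Union>i<Suc k. E i)) \<le> \<mu> (E j \<inter> (\<Union>i<k. E i)) + \<mu> (E k \<inter> E j)"
        unfolding eq Int_Un_distrib mean_Un[OF m]
        by (auto intro!: mean_mono[OF m])
      also have "\<dots> = 0" using IH(2)[of j] null[of k j] j by auto
      finally show ?thesis using mean_nonneg[OF m, of "E j \<inter> (\<Union>i<Suc k. E i)"] by simp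
    qed
    then show ?case using 1 by auto
  qed
  from this[of n] show ?thesis using mean_le_1[OF m, of "\<Union>i<n. E i"] by auto
qed

section \<open>Compactness of the space of means\<close>

lemma compact_unit_cube: "compact {f :: 'a \<Rightarrow> real. \<forall>x. f x \<in> {0..1}}"
proof -
  have "compactin (product_topology (\<lambda>_. euclidean) UNIV) (PiE UNIV (\<lambda>_ :: 'a. {0..1::real}))"
    by (subst compactin_PiE) (auto simp: compactin_euclidean_iff)
  then show ?thesis
    by (simp add: euclidean_product_topology compactin_euclidean_iff PiE_UNIV_domain Pi_def)
qed

lemma closed_mean: "closed {\<mu>. mean \<mu>}"
  unfolding mean_def
  by (intro closed_Collect_conj closed_Collect_all closed_Collect_imp closed_Collect_le
        closed_Collect_eq continuous_intros continuous_on_product_coordinates open_Collect_const)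

lemma compact_mean: "compact {\<mu> :: 'a set \<Rightarrow> real. mean \<mu>}"
proof -
  have "{\<mu>. mean \<mu>} = {f. \<forall>x. f x \<in> {0..1}} \<inter> {\<mu> :: 'a set \<Rightarrow> real. mean \<mu>}"
    using mean_nonneg mean_le_1 by auto
  then show ?thesis
    using compact_Int_closed[OF compact_unit_cube closed_mean] by metis
qed

section \<open>Translations and invariant means\<close>

definition shift :: "'a::ab_group_add \<Rightarrow> 'a set \<Rightarrow> 'a set" where
  "shift g E = {x. x - g \<in> E}"

lemma mem_shift [simp]: "x \<in> shift g E \<longleftrightarrow> x - g \<in> E"
  by (simp add: shift_def)

lemma shift_shift [simp]: "shift g (shift h E) = shift (g + h) E"
  by (auto simp: algebra_simps)

lemma shift_0 [simp]: "shift 0 E = E"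
  by auto

lemma shift_Int: "shift g (E \<inter> F) = shift g E \<inter> shift g F"
  and shift_Un: "shift g (E \<union> F) = shift g E \<union> shift g F"
  and shift_UNIV: "shift g UNIV = UNIV"
  by auto

definition invariant :: "('a::ab_group_add set \<Rightarrow> real) \<Rightarrow> bool" where
  "invariant \<mu> \<longleftrightarrow> (\<forall>g E. \<mu> (shift g E) = \<mu> E)"

lemma invariant_shift: "invariant \<mu> \<Longrightarrow> \<mu> (shift g E) = \<mu> E"
  by (simp add: invariant_def)

lemma closed_invariant: "closed {\<mu>. invariant \<mu>}"
  unfolding invariant_def
  by (intro closed_Collect_all closed_Collect_eq continuous_on_product_coordinates)

text \<open>Each condition of approximate invariance is closed, and finitely many of them hold
  together in \<open>Q\<close>; compactness of the space of means then gives a common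
  solution.\<close>

lemma invariant_mean_from_approximate:
  fixes Q :: "('a::ab_group_add set \<Rightarrow> real) set"
  assumes "closed Q"
    and approx: "\<And>S \<epsilon>. finite S \<Longrightarrow> 0 < \<epsilon> \<Longrightarrow>
      \<exists>\<nu>\<in>Q. mean \<nu> \<and> (\<forall>g\<in>S. \<forall>E. \<bar>\<nu> (shift g E) - \<nu> E\<bar> \<le> \<epsilon>)"
  shows "\<exists>\<nu>\<in>Q. mean \<nu> \<and> invariant \<nu>"
proof -
  define C where "C = (\<lambda>(g, n). {\<nu> :: 'a set \<Rightarrow> real. \<forall>E. \<bar>\<nu> (shift g E) - \<nu> E\<bar> \<le> inverse (real (Suc n))})"
  have "({\<mu>. mean \<mu>} \<inter> Q) \<inter> (\<Inter>i\<in>UNIV. C i) \<noteq> {}"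
  proof (rule compact_imp_fip_image)
    show "compact ({\<mu>. mean \<mu>} \<inter> Q)"
      using compact_mean assms(1) by (rule compact_Int_closed)
    show "closed (C i)" for i
      unfolding C_def by (cases i) (simp, intro closed_Collect_all closed_Collect_le
          continuous_intros continuous_on_product_coordinates)
    fix I :: "('a \<times> nat) set" assume "finite I"
    define m where "m = Max (insert 0 (snd ` I))"
    obtain \<nu> where \<nu>: "\<nu> \<in> Q" "mean \<nu>"
      "\<And>g E. g \<in> fst ` I \<Longrightarrow> \<bar>\<nu> (shift g E) - \<nu> E\<bar> \<le> inverse (real (Suc m))"
      using approx[OF finite_imageI[OF \<open>finite I\<close>, of fst], of "inverse (real (Suc m))"] by auto
    have "\<nu> \<in> C i" if "i \<in> I" for i
    proof -
      obtain g n where i: "i = (g, n)" by (cases i)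
      have "n \<le> m" unfolding m_def using \<open>finite I\<close> that i by (force intro: Max_ge)
      then have "inverse (real (Suc m)) \<le> inverse (real (Suc n))" by (simp add: le_imp_inverse_le)
      moreover have "g \<in> fst ` I" using that i by force
      ultimately have "\<bar>\<nu> (shift g E) - \<nu> E\<bar> \<le> inverse (real (Suc n))" for E
        using \<nu>(3)[of g E] by linarith
      then show ?thesis unfolding C_def i by simp
    qed
    then show "{\<mu>. mean \<mu>} \<inter> Q \<inter> (\<Inter>i\<in>I. C i) \<noteq> {}" using \<nu>(1,2) by blast
  qed
  then obtain \<nu> where \<nu>: "mean \<nu>" "\<nu> \<in> Q" "\<And>i. \<nu> \<in> C i" by blast
  have "\<nu> (shift g E) = \<nu> E" for g E
  proof (rule ccontr)
    assume "\<nu> (shift g E) \<noteq> \<nu> E"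
    then obtain n where "inverse (real (Suc n)) < \<bar>\<nu> (shift g E) - \<nu> E\<bar>"
      using reals_Archimedean[of "\<bar>\<nu> (shift g E) - \<nu> E\<bar>"] by auto
    moreover have "\<bar>\<nu> (shift g E) - \<nu> E\<bar> \<le> inverse (real (Suc n))"
      using \<nu>(3)[of "(g, n)"] by (auto simp: C_def)
    ultimately show False by simp
  qed
  with \<nu> show ?thesis by (auto simp: invariant_def)
qed

primrec nmul :: "nat \<Rightarrow> 'a::ab_group_add \<Rightarrow> 'a" where
  "nmul 0 g = 0"
| "nmul (Suc n) g = g + nmul n g"

lemma nmul_add: "nmul (m + n) g = nmul m g + nmul n g"
  by (induction m) (simp_all add: add.assoc)

lemma nmul_mult: "nmul (m * n) g = nmul m (nmul n g)"
  by (induction m) (simp_all add: nmul_add)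

lemma sum_Suc_diff_le:
  fixes a :: "nat \<Rightarrow> real"
  assumes "\<And>c. 0 \<le> a c" "\<And>c. a c \<le> B"
  shows "\<bar>(\<Sum>c<L. a (Suc c)) - (\<Sum>c<L. a c)\<bar> \<le> B"
proof -
  have "(\<Sum>c<L. a (Suc c)) - (\<Sum>c<L. a c) = a L - a 0"
    by (simp add: sum_subtractf[symmetric] sum_lessThan_telescope)
  then show ?thesis using assms[of 0] assms[of L] by linarith
qed

text \<open>The witness is the multiset of all \<open>c\<^sub>1 g\<^sub>1 + \<dots> + c\<^sub>r g\<^sub>r\<close> with \<open>0 \<le> c\<^sub>i < L\<close>.\<close>

lemma almost_invariant_list:
  fixes S :: "'a::ab_group_add set"
  assumes "finite S" "0 < \<epsilon>"
  shows "\<exists>fs. fs \<noteq> [] \<and> (\<forall>g\<in>S. \<forall>\<phi>. (\<forall>x. 0 \<le> \<phi> x \<and> \<phi> x \<le> 1) \<longrightarrow>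
    \<bar>(\<Sum>f\<leftarrow>fs. \<phi> (f + g)) - (\<Sum>f\<leftarrow>fs. \<phi> f)\<bar> \<le> \<epsilon> * real (length fs))"
  using assms(1)
proof (induction S)
  case empty
  then show ?case by (intro exI[of _ "[0]"]) simp
next
  case (insert g0 S)
  then obtain fs where fs: "fs \<noteq> []" and inv: "\<And>g \<phi>. g \<in> S \<Longrightarrow> (\<forall>x. 0 \<le> \<phi> x \<and> \<phi> x \<le> 1) \<Longrightarrow>
    \<bar>(\<Sum>f\<leftarrow>fs. \<phi> (f + g)) - (\<Sum>f\<leftarrow>fs. \<phi> f)\<bar> \<le> \<epsilon> * real (length fs)" by blast
  \<comment> \<open>Each \<open>f\<close> becomes a progression of \<open>L\<close> steps in
    direction \<open>g0\<close>. A shift by \<open>g0\<close> telescopes to the two end terms, a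
    change of at most \<open>length fs\<close>, which is an \<epsilon> fraction of the new
    length.\<close>
  obtain L :: nat where L: "1 / \<epsilon> < real L" using reals_Archimedean2 by blast
  then have Lpos: "0 < real L" using assms(2) by (meson less_trans zero_less_divide_1_iff)
  have L1: "1 \<le> \<epsilon> * real L" using L assms(2) by (simp add: field_simps)
  define fs' where "fs' = concat (map (\<lambda>c. map (\<lambda>f. f + nmul c g0) fs) [0..<L])"
  have sum': "(\<Sum>f\<leftarrow>fs'. \<phi> f) = (\<Sum>c<L. \<Sum>f\<leftarrow>fs. \<phi> (f + nmul c g0))" for \<phi> :: "'a \<Rightarrow> real"
    unfolding fs'_def by (induction L) (simp_all add: comp_def)
  have len: "length fs' = L * length fs"
    unfolding fs'_def by (induction L) simp_all
  have "fs' \<noteq> []" using len fs Lpos by (metis length_0_conv mult_is_0 of_nat_0 order_less_irrefl)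
  moreover have "\<bar>(\<Sum>f\<leftarrow>fs'. \<phi> (f + g)) - (\<Sum>f\<leftarrow>fs'. \<phi> f)\<bar> \<le> \<epsilon> * real (length fs')"
    if "g \<in> insert g0 S" and \<phi>: "\<forall>x. 0 \<le> \<phi> x \<and> \<phi> x \<le> 1" for g \<phi>
  proof (cases "g \<in> S")
    case True
    have "\<bar>(\<Sum>f\<leftarrow>fs'. \<phi> (f + g)) - (\<Sum>f\<leftarrow>fs'. \<phi> f)\<bar> =
      \<bar>\<Sum>c<L. ((\<Sum>f\<leftarrow>fs. \<phi> (f + g + nmul c g0)) - (\<Sum>f\<leftarrow>fs. \<phi> (f + nmul c g0)))\<bar>"
      unfolding sum' sum_subtractf by (simp add: ac_simps)
    also have "\<dots> \<le> (\<Sum>c<L. \<epsilon> * real (length fs))"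
      by (intro order_trans[OF sum_abs] sum_mono inv True) (use \<phi> in auto)
    also have "\<dots> = \<epsilon> * real (length fs')" by (simp add: len)
    finally show ?thesis .
  next
    case False
    then have g: "g = g0" using that by simp
    have bd: "0 \<le> (\<Sum>f\<leftarrow>fs. \<psi> f)" "(\<Sum>f\<leftarrow>fs. \<psi> f) \<le> real (length fs)"
      if "\<forall>x. 0 \<le> \<psi> x \<and> \<psi> x \<le> 1" for \<psi> :: "'a \<Rightarrow> real"
    proof -
      show "0 \<le> (\<Sum>f\<leftarrow>fs. \<psi> f)" by (intro sum_list_nonneg) (use that in auto)
      have "(\<Sum>f\<leftarrow>fs. \<psi> f) \<le> (\<Sum>f\<leftarrow>fs. 1)" by (intro sum_list_mono) (use that in auto)
      then show "(\<Sum>f\<leftarrow>fs. \<psi> f) \<le> real (length fs)" by (simp add: sum_list_triv)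
    qed
    have "\<bar>(\<Sum>f\<leftarrow>fs'. \<phi> (f + g)) - (\<Sum>f\<leftarrow>fs'. \<phi> f)\<bar> \<le> real (length fs)"
    proof -
      define a where "a c = (\<Sum>f\<leftarrow>fs. \<phi> (f + nmul c g0))" for c
      have "\<bar>(\<Sum>c<L. a (Suc c)) - (\<Sum>c<L. a c)\<bar> \<le> real (length fs)"
        by (rule sum_Suc_diff_le) (unfold a_def, (rule bd, use \<phi> in simp)+)
      then show ?thesis unfolding sum' g a_def by (simp add: ac_simps)
    qed
    also have "\<dots> \<le> \<epsilon> * real (length fs')"
      using mult_right_mono[OF L1, of "real (length fs)"] by (simp add: len)
    finally show ?thesis .
  qed
  ultimately show ?case by blast
qed

lemma mean_average:
  fixes w :: "'b list"
  assumes "w \<noteq> []" "\<And>f. f \<in> set w \<Longrightarrow> mean (\<nu> f)"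
  shows "mean (\<lambda>E. (\<Sum>f\<leftarrow>w. \<nu> f E) / real (length w))"
proof -
  have *: "(\<Sum>f\<leftarrow>w. \<nu> f (E \<union> F)) = (\<Sum>f\<leftarrow>w. \<nu> f E) + (\<Sum>f\<leftarrow>w. \<nu> f F)" if "E \<inter> F = {}" for E F
    unfolding sum_list_addf[symmetric]
    by (intro arg_cong[where f=sum_list] map_cong refl) (simp add: mean_disjoint assms that)
  have "(\<Sum>f\<leftarrow>w. \<nu> f UNIV) = (\<Sum>f\<leftarrow>w. 1)"
    by (intro arg_cong[where f=sum_list] map_cong refl) (simp add: mean_UNIV assms)
  then show ?thesis unfolding mean_def using * assms
    by (auto intro!: divide_nonneg_nonneg sum_list_nonneg simp: mean_nonneg add_divide_distrib sum_list_triv)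
qed

text \<open>Upper Banach density at least \<open>\<delta>\<close>. The finite windows are lists, so a window may repeat elements;
  this lets averages over iterated progressions be formed without checking distinctness.\<close>

definition banach_density_ge :: "real \<Rightarrow> 'a::ab_group_add set \<Rightarrow> bool" where
  "banach_density_ge \<delta> A \<longleftrightarrow> (\<forall>fs. fs \<noteq> [] \<longrightarrow>
     (\<exists>h. \<delta> * real (length fs) \<le> (\<Sum>f\<leftarrow>fs. indicat_real A (h + f))))"

text \<open>Averages of point masses over almost invariant windows, each moved to where a proportion
  \<delta> of it lies in \<open>A\<close>, are approximately invariant; the condition
  \<open>\<delta> \<le> \<nu> A\<close> is closed and survives the limit.\<close>

lemma invariant_mean_of_dense:
  assumes "banach_density_ge \<delta> A"
  shows "\<exists>\<mu>. mean \<mu> \<and> invariant \<mu> \<and> \<delta> \<le> \<mu> A"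
proof -
  have "\<exists>\<nu>\<in>{\<nu>. \<delta> \<le> \<nu> A}. mean \<nu> \<and> invariant \<nu>"
  proof (rule invariant_mean_from_approximate)
    show "closed {\<nu>. \<delta> \<le> \<nu> A}"
      by (intro closed_Collect_le continuous_intros continuous_on_product_coordinates)
    fix S :: "'a set" and \<epsilon> :: real assume "finite S" "0 < \<epsilon>"
    \<comment> \<open>Negated, because translating \<open>E\<close> by \<open>g\<close> moves the
      sample points by \<open>- g\<close>.\<close>
    then obtain fs where fs: "fs \<noteq> []" and inv: "\<And>g \<phi>. g \<in> uminus ` S \<Longrightarrow> (\<forall>x. 0 \<le> \<phi> x \<and> \<phi> x \<le> 1) \<Longrightarrow>
      \<bar>(\<Sum>f\<leftarrow>fs. \<phi> (f + g)) - (\<Sum>f\<leftarrow>fs. \<phi> f)\<bar> \<le> \<epsilon> * real (length fs)"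
      using almost_invariant_list[of "uminus ` S" \<epsilon>] by blast
    obtain h where h: "\<delta> * real (length fs) \<le> (\<Sum>f\<leftarrow>fs. indicat_real A (h + f))"
      using assms fs unfolding banach_density_ge_def by blast
    define \<nu> where "\<nu> E = (\<Sum>f\<leftarrow>fs. indicat_real E (h + f)) / real (length fs)" for E
    have "mean \<nu>" unfolding \<nu>_def
      by (rule mean_average[OF fs]) (auto simp: mean_def indicator_def)
    moreover have "\<nu> \<in> {\<nu>. \<delta> \<le> \<nu> A}" using h fs by (simp add: \<nu>_def field_simps)
    moreover have "\<bar>\<nu> (shift g E) - \<nu> E\<bar> \<le> \<epsilon>" if "g \<in> S" for g E
    proof -
      have "\<bar>(\<Sum>f\<leftarrow>fs. indicat_real E (h + (f + - g))) - (\<Sum>f\<leftarrow>fs. indicat_real E (h + f))\<bar>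
          \<le> \<epsilon> * real (length fs)"
        using inv[of "- g" "\<lambda>f. indicat_real E (h + f)"] that by auto
      moreover have "indicat_real (shift g E) (h + f) = indicat_real E (h + (f + - g))" for f
        by (simp add: indicator_def algebra_simps)
      ultimately show ?thesis
        using fs by (simp add: \<nu>_def diff_divide_distrib[symmetric] field_simps)
    qed
    ultimately show "\<exists>\<nu>\<in>{\<nu>. \<delta> \<le> \<nu> A}. mean \<nu> \<and> (\<forall>g\<in>S. \<forall>E. \<bar>\<nu> (shift g E) - \<nu> E\<bar> \<le> \<epsilon>)"
      by blast
  qed
  then show ?thesis by blast
qed

text \<open>Ergodicity is phrased as extremality among invariant means.\<close>

definition ergodic :: "('a::ab_group_add set \<Rightarrow> real) \<Rightarrow> bool" where
  "ergodic \<mu> \<longleftrightarrow> mean \<mu> \<and> invariant \<mu> \<and>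
     (\<forall>\<nu> p. mean \<nu> \<longrightarrow> invariant \<nu> \<longrightarrow> 0 < p \<longrightarrow> (\<forall>E. p * \<nu> E \<le> \<mu> E) \<longrightarrow> \<nu> = \<mu>)"

text \<open>A sequence of windows violating this would produce, by compactness, an invariant mean that is
  dominated by a multiple of \<open>\<mu>\<close> but differs from it. The uniformity in \<open>h\<close> is what allows the
  window to be moved to a place where a dense set is actually dense.\<close>

lemma ergodic_average:
  assumes erg: "ergodic \<mu>" and "0 < \<epsilon>"
  shows "\<exists>fs. fs \<noteq> [] \<and> (\<forall>h. \<bar>(\<Sum>f\<leftarrow>fs. \<mu> (Z \<inter> shift (h + f) E)) - real (length fs) * (\<mu> Z * \<mu> E)\<bar>
    \<le> \<epsilon> * real (length fs))"
\<comment> \<open>Conditioning on \<open>Z\<close> requires positive mean; for a null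
  \<open>Z\<close> every term vanishes and any window works.\<close>
proof (cases "\<mu> Z = 0")
  case True
  have m: "mean \<mu>" using erg by (simp add: ergodic_def)
  have "\<mu> (Z \<inter> F) = 0" for F
    using mean_mono[OF m, of "Z \<inter> F" Z] mean_nonneg[OF m, of "Z \<inter> F"] True by simp
  then show ?thesis using assms(2) True by (intro exI[of _ "[0]"]) auto
next
  case False
  have m: "mean \<mu>" and i: "invariant \<mu>" using erg by (auto simp: ergodic_def)
  have Z: "0 < \<mu> Z" using False mean_nonneg[OF m, of Z] by simp
  show ?thesis
  proof (rule ccontr)
    assume neg: "\<not> ?thesis"
    \<comment> \<open>Domination by \<mu> and a definite difference from it at \<open>E\<close>,
      both as non-strict inequalities, so that \<open>Q\<close> is closed.\<close>
    define Q where "Q = {\<nu>. (\<forall>Y. \<mu> Z * \<nu> Y \<le> \<mu> Y) \<and> \<epsilon> \<le> \<mu> Z * \<bar>\<nu> E - \<mu> E\<bar>}"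
    have "\<exists>\<nu>\<in>Q. mean \<nu> \<and> invariant \<nu>"
    proof (rule invariant_mean_from_approximate)
      show "closed Q" unfolding Q_def
        by (intro closed_Collect_conj closed_Collect_all closed_Collect_le continuous_intros
            continuous_on_product_coordinates)
      fix S :: "'a set" and \<eta> :: real assume "finite S" "0 < \<eta>"
      then obtain fs where fs: "fs \<noteq> []" and inv: "\<And>g \<phi>. g \<in> S \<Longrightarrow> (\<forall>x. 0 \<le> \<phi> x \<and> \<phi> x \<le> 1) \<Longrightarrow>
        \<bar>(\<Sum>f\<leftarrow>fs. \<phi> (f + g)) - (\<Sum>f\<leftarrow>fs. \<phi> f)\<bar> \<le> \<eta> * real (length fs)"
        using almost_invariant_list[of S \<eta>] by blast
      have len: "0 < real (length fs)" using fs by simp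
      obtain h where h: "\<epsilon> * real (length fs) <
        \<bar>(\<Sum>f\<leftarrow>fs. \<mu> (Z \<inter> shift (h + f) E)) - real (length fs) * (\<mu> Z * \<mu> E)\<bar>"
        using neg fs by (auto simp: not_le)
      \<comment> \<open>This is \<mu> conditioned on \<open>Z\<close> and read through a
        translation; invariance of \<mu> bounds it by \<open>\<mu> Y / \<mu> Z\<close>.\<close>
      define \<nu>0 where "\<nu>0 f Y = \<mu> (Z \<inter> shift (h + f) Y) / \<mu> Z" for f Y
      define \<nu> where "\<nu> Y = (\<Sum>f\<leftarrow>fs. \<nu>0 f Y) / real (length fs)" for Y
      have \<nu>0: "mean (\<nu>0 f)" for f
        unfolding mean_def
      proof (intro conjI allI impI)
        fix Y show "0 \<le> \<nu>0 f Y" using Z by (simp add: \<nu>0_def mean_nonneg[OF m])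
      next
        show "\<nu>0 f UNIV = 1" using Z by (simp add: \<nu>0_def shift_UNIV)
      next
        fix Y W :: "'a set" assume "Y \<inter> W = {}"
        then have "Z \<inter> shift (h + f) Y \<inter> (Z \<inter> shift (h + f) W) = {}" by auto
        from mean_disjoint[OF m this] show "\<nu>0 f (Y \<union> W) = \<nu>0 f Y + \<nu>0 f W"
          by (simp add: \<nu>0_def shift_Un Int_Un_distrib add_divide_distrib)
      qed
      have mean: "mean \<nu>" unfolding \<nu>_def by (rule mean_average[OF fs \<nu>0])
      have "\<mu> Z * \<nu> Y \<le> \<mu> Y" for Y
      proof -
        have "(\<Sum>f\<leftarrow>fs. \<nu>0 f Y) \<le> (\<Sum>f\<leftarrow>fs. \<mu> Y / \<mu> Z)"
        proof (intro sum_list_mono)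
          fix f
          have "\<mu> (Z \<inter> shift (h + f) Y) \<le> \<mu> (shift (h + f) Y)" by (rule mean_mono[OF m]) auto
          then show "\<nu>0 f Y \<le> \<mu> Y / \<mu> Z"
            using Z by (simp add: \<nu>0_def invariant_shift[OF i] divide_right_mono)
        qed
        then have "\<nu> Y \<le> \<mu> Y / \<mu> Z" using len by (simp add: \<nu>_def sum_list_triv field_simps)
        then show ?thesis using Z by (simp add: field_simps)
      qed
      moreover have "\<epsilon> \<le> \<mu> Z * \<bar>\<nu> E - \<mu> E\<bar>"
      proof -
        have "(\<Sum>f\<leftarrow>fs. \<nu>0 f E) = (\<Sum>f\<leftarrow>fs. \<mu> (Z \<inter> shift (h + f) E)) / \<mu> Z"
          unfolding \<nu>0_def by (simp add: divide_inverse sum_list_mult_const)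
        then have "(\<Sum>f\<leftarrow>fs. \<mu> (Z \<inter> shift (h + f) E)) = real (length fs) * (\<mu> Z * \<nu> E)"
          using Z len by (simp add: \<nu>_def)
        with h have "\<epsilon> * real (length fs) < \<bar>real (length fs) * (\<mu> Z * (\<nu> E - \<mu> E))\<bar>"
          by (simp add: algebra_simps)
        also have "\<dots> = (\<mu> Z * \<bar>\<nu> E - \<mu> E\<bar>) * real (length fs)"
          using Z by (simp add: abs_mult)
        finally show ?thesis using len by simp
      qed
      ultimately have "\<nu> \<in> Q" by (simp add: Q_def)
      moreover have "\<bar>\<nu> (shift g Y) - \<nu> Y\<bar> \<le> \<eta>" if "g \<in> S" for g Y
      proof -
        \<comment> \<open>Translating the set translates the index, so almost invariance of the
          window passes to \<nu>.\<close>
        have "\<nu>0 f (shift g Y) = \<nu>0 (f + g) Y" for f by (simp add: \<nu>0_def add.assoc)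
        then have "\<bar>(\<Sum>f\<leftarrow>fs. \<nu>0 f (shift g Y)) - (\<Sum>f\<leftarrow>fs. \<nu>0 f Y)\<bar> \<le> \<eta> * real (length fs)"
          using inv[OF that, of "\<lambda>f. \<nu>0 f Y"] mean_nonneg[OF \<nu>0] mean_le_1[OF \<nu>0] by simp
        then show ?thesis
          using fs by (simp add: \<nu>_def diff_divide_distrib[symmetric] field_simps)
      qed
      ultimately show "\<exists>\<nu>\<in>Q. mean \<nu> \<and> (\<forall>g\<in>S. \<forall>E. \<bar>\<nu> (shift g E) - \<nu> E\<bar> \<le> \<eta>)"
        using mean by blast
    qed
    then obtain \<nu> where \<nu>: "mean \<nu>" "invariant \<nu>" "\<And>Y. \<mu> Z * \<nu> Y \<le> \<mu> Y"
      "\<epsilon> \<le> \<mu> Z * \<bar>\<nu> E - \<mu> E\<bar>" by (auto simp: Q_def)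
    then have "\<nu> = \<mu>" using erg Z unfolding ergodic_def by blast
    then show False using \<nu>(4) assms(2) by simp
  qed
qed

section \<open>Faces and existence of ergodic means\<close>

text \<open>Closed extremal sets of invariant means: domination of \<open>p * \<nu> E\<close> by
  \<open>\<mu> E\<close> says that \<nu> occurs with weight \<open>p\<close> in a convex
  decomposition of \<mu>.\<close>

definition face :: "('a::ab_group_add set \<Rightarrow> real) set \<Rightarrow> bool" where
  "face \<Phi> \<longleftrightarrow> closed \<Phi> \<and> \<Phi> \<noteq> {} \<and> (\<forall>\<mu>\<in>\<Phi>. mean \<mu> \<and> invariant \<mu>) \<and>
     (\<forall>\<mu>\<in>\<Phi>. \<forall>\<nu> p. mean \<nu> \<longrightarrow> invariant \<nu> \<longrightarrow> 0 < p \<longrightarrow> (\<forall>E. p * \<nu> E \<le> \<mu> E) \<longrightarrow> \<nu> \<in> \<Phi>)"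

lemma face_absorb:
  assumes "face \<Phi>" "\<mu> \<in> \<Phi>" "mean \<nu>" "invariant \<nu>" "0 < p" "\<forall>E. p * \<nu> E \<le> \<mu> E"
  shows "\<nu> \<in> \<Phi>"
  using assms unfolding face_def by blast

lemma face_compact: "face \<Phi> \<Longrightarrow> compact \<Phi>"
  using closed_Int_compact[OF _ compact_mean, of \<Phi>] by (auto simp: face_def Int_absorb2 subset_iff)

text \<open>Evaluation at \<open>E\<close> attains its maximum on a compact face, and when a convex
  combination is maximal at \<open>E\<close>, so are its components.\<close>

lemma face_maximizers:
  assumes "face \<Phi>"
  shows "face {\<mu>\<in>\<Phi>. \<forall>\<mu>'\<in>\<Phi>. \<mu>' E \<le> \<mu> E}"
proof -
  have ne: "\<Phi> \<noteq> {}" and cl: "closed \<Phi>" and inv: "\<And>\<mu>. \<mu> \<in> \<Phi> \<Longrightarrow> mean \<mu> \<and> invariant \<mu>"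
    using assms by (auto simp: face_def)
  have "continuous_on \<Phi> (\<lambda>\<mu>. \<mu> E)"
    by (rule continuous_on_subset[OF continuous_on_product_coordinates subset_UNIV])
  from continuous_attains_sup[OF face_compact[OF assms] ne this]
  have "{\<mu>\<in>\<Phi>. \<forall>\<mu>'\<in>\<Phi>. \<mu>' E \<le> \<mu> E} \<noteq> {}" by blast
  moreover have "closed {\<mu>\<in>\<Phi>. \<forall>\<mu>'\<in>\<Phi>. \<mu>' E \<le> \<mu> E}"
  proof -
    have eq: "{\<mu>\<in>\<Phi>. \<forall>\<mu>'\<in>\<Phi>. \<mu>' E \<le> \<mu> E} = \<Phi> \<inter> (\<Inter>\<mu>'\<in>\<Phi>. {\<mu>. \<mu>' E \<le> \<mu> E})" by auto
    have "closed {\<mu>. \<mu>' E \<le> \<mu> E}" for \<mu>' :: "'a set \<Rightarrow> real"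
      by (intro closed_Collect_le continuous_intros continuous_on_product_coordinates)
    then show ?thesis unfolding eq by (intro closed_Int closed_INT cl ballI)
  qed
  moreover have "mean \<mu> \<and> invariant \<mu>" if "\<mu> \<in> {\<mu>\<in>\<Phi>. \<forall>\<mu>'\<in>\<Phi>. \<mu>' E \<le> \<mu> E}" for \<mu>
    using inv that by blast
  moreover have "\<nu> \<in> \<Phi> \<and> (\<forall>\<mu>'\<in>\<Phi>. \<mu>' E \<le> \<nu> E)"
    if \<mu>: "\<mu> \<in> \<Phi>" "\<forall>\<mu>'\<in>\<Phi>. \<mu>' E \<le> \<mu> E" and \<nu>: "mean \<nu>" "invariant \<nu>"
      and p: "0 < p" "\<And>Y. p * \<nu> Y \<le> \<mu> Y" for \<mu> \<nu> p
  proof -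
    have m: "mean \<mu>" "invariant \<mu>" using inv \<mu>(1) by auto
    have in_face: "\<nu> \<in> \<Phi>" using face_absorb[OF assms \<mu>(1) \<nu> p(1)] p(2) by blast
    have "p \<le> 1" using p(2)[of UNIV] by (simp add: mean_UNIV m \<nu>)
    have "\<mu> E \<le> \<nu> E"
    \<comment> \<open>For \<open>p = 1\<close> there is no complementary component; domination on
      the complement of \<open>E\<close> gives the bound directly.\<close>
    proof (cases "p = 1")
      case True
      then show ?thesis using p(2)[of "- E"] by (simp add: mean_Compl m \<nu>)
    next
      case False
      then have p1: "0 < 1 - p" using \<open>p \<le> 1\<close> by simp
      \<comment> \<open>The complementary component,
        \<open>\<mu> = p \<nu> + (1 - p) \<rho>\<close>. It lies in the face, so it cannot exceed
        \<mu> at \<open>E\<close>, and hence \<nu> cannot fall below \<mu> there.\<close>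
      define \<rho> where "\<rho> Y = (\<mu> Y - p * \<nu> Y) / (1 - p)" for Y
      have "mean \<rho>" unfolding mean_def
      proof (intro conjI allI impI)
        show "0 \<le> \<rho> Y" for Y using p(2)[of Y] p1 by (simp add: \<rho>_def)
        show "\<rho> UNIV = 1" using p1 by (simp add: \<rho>_def mean_UNIV m \<nu>)
        fix Y W :: "'a set" assume "Y \<inter> W = {}"
        then have "\<mu> (Y \<union> W) - p * \<nu> (Y \<union> W) = (\<mu> Y - p * \<nu> Y) + (\<mu> W - p * \<nu> W)"
          by (simp add: mean_disjoint m \<nu> algebra_simps)
        then show "\<rho> (Y \<union> W) = \<rho> Y + \<rho> W" by (simp add: \<rho>_def add_divide_distrib)
      qed
      moreover have "invariant \<rho>" unfolding invariant_def \<rho>_def by (simp add: invariant_shift m \<nu>)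
      moreover have "(1 - p) * \<rho> Y \<le> \<mu> Y" for Y
        using p1 p(1) mean_nonneg[OF \<nu>(1), of Y] by (simp add: \<rho>_def)
      ultimately have "\<rho> \<in> \<Phi>" using face_absorb[OF assms \<mu>(1) _ _ p1] by blast
      then have "\<rho> E \<le> \<mu> E" using \<mu>(2) by blast
      then have "p * \<mu> E \<le> p * \<nu> E" using p1 by (simp add: \<rho>_def field_simps)
      then show ?thesis using p(1) by simp
    qed
    with \<mu>(2) in_face show ?thesis using order_trans by blast
  qed
  ultimately show ?thesis unfolding face_def by blast
qed

text \<open>Nonemptiness comes from compactness: finitely many members of a chain contain a common
  member.\<close>

lemma face_Inter_chain:
  assumes "C \<noteq> {}" "\<And>\<Phi>. \<Phi> \<in> C \<Longrightarrow> face \<Phi>" "\<And>\<Phi> \<Psi>. \<Phi> \<in> C \<Longrightarrow> \<Psi> \<in> C \<Longrightarrow> \<Phi> \<subseteq> \<Psi> \<or> \<Psi> \<subseteq> \<Phi>"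
  shows "face (\<Inter>C)"
proof -
  obtain \<Phi>0 where \<Phi>0: "\<Phi>0 \<in> C" using assms(1) by blast
  have "\<Phi>0 \<inter> \<Inter>C \<noteq> {}"
  proof (rule compact_imp_fip)
    show "compact \<Phi>0" using assms(2) \<Phi>0 face_compact by blast
    show "closed \<Phi>" if "\<Phi> \<in> C" for \<Phi> using assms(2)[OF that] by (simp add: face_def)
    fix F assume F: "finite F" "F \<subseteq> C"
    have *: "\<exists>\<Psi>\<in>C. \<Psi> \<subseteq> \<Phi>0 \<inter> \<Inter>F"
      using F
    proof (induction F)
      case empty
      then show ?case using \<Phi>0 by auto
    next
      case (insert \<Phi> F)
      then obtain \<Psi> where \<Psi>: "\<Psi> \<in> C" "\<Psi> \<subseteq> \<Phi>0 \<inter> \<Inter>F" by auto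
      have \<Phi>: "\<Phi> \<in> C" using insert by auto
      consider "\<Phi> \<subseteq> \<Psi>" | "\<Psi> \<subseteq> \<Phi>" using assms(3)[OF \<Phi> \<Psi>(1)] by blast
      then show ?case
      proof cases
        case 1
        then show ?thesis using \<Psi> by (intro bexI[OF _ \<Phi>]) auto
      next
        case 2
        then show ?thesis using \<Psi> by (intro bexI[OF _ \<Psi>(1)]) auto
      qed
    qed
    have "\<Psi> \<noteq> {}" if "\<Psi> \<in> C" for \<Psi> using assms(2)[OF that] by (simp add: face_def)
    with * have "\<Phi>0 \<inter> \<Inter>F \<noteq> {}" by (elim bexE) (simp only: subset_empty[symmetric], metis subset_trans)
    then show "\<Phi>0 \<inter> \<Inter>F \<noteq> {}" .
  qed
  then have "\<Inter>C \<noteq> {}" by blast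
  moreover have "closed (\<Inter>C)" using assms(2) by (auto simp: face_def)
  moreover have "mean \<mu> \<and> invariant \<mu>" if "\<mu> \<in> \<Inter>C" for \<mu>
    using assms(2)[OF \<Phi>0] \<Phi>0 that by (auto simp: face_def)
  moreover have "\<nu> \<in> \<Inter>C"
    if "\<mu> \<in> \<Inter>C" "mean \<nu>" "invariant \<nu>" "0 < p" "\<forall>E. p * \<nu> E \<le> \<mu> E" for \<mu> \<nu> p
    using that assms(2) face_absorb by blast
  ultimately show ?thesis unfolding face_def by blast
qed

lemma face_singleton_ergodic:
  assumes "face {\<mu>}"
  shows "ergodic \<mu>"
  using assms unfolding face_def ergodic_def by blast

text \<open>A Krein-Milman argument: a minimal face inside the face of maximisers at
  \<open>A\<close> is a single point, since evaluation at every \<open>E\<close> is constant on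
  it.\<close>

lemma ergodic_mean_of_dense:
  assumes "banach_density_ge \<delta> A"
  shows "\<exists>\<mu>. ergodic \<mu> \<and> \<delta> \<le> \<mu> A"
proof -
  obtain \<mu>0 where \<mu>0: "mean \<mu>0" "invariant \<mu>0" "\<delta> \<le> \<mu>0 A"
    using invariant_mean_of_dense[OF assms] by blast
  have "face {\<mu> :: 'a set \<Rightarrow> real. mean \<mu> \<and> invariant \<mu>}"
    using \<mu>0 by (auto simp: face_def intro!: closed_Collect_conj closed_mean closed_invariant)
  note face_maximizers[OF this, of A]
  moreover define \<Phi>A where "\<Phi>A = {\<mu> \<in> {\<mu> :: 'a set \<Rightarrow> real. mean \<mu> \<and> invariant \<mu>}.
    \<forall>\<mu>'\<in>{\<mu>. mean \<mu> \<and> invariant \<mu>}. \<mu>' A \<le> \<mu> A}"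
  ultimately have \<Phi>A: "face \<Phi>A" by simp
  have dense: "\<delta> \<le> \<mu> A" if "\<mu> \<in> \<Phi>A" for \<mu>
    using that \<mu>0 order_trans[of \<delta> "\<mu>0 A" "\<mu> A"] unfolding \<Phi>A_def by blast
  \<comment> \<open>Complements, since Zorn's lemma yields a maximal element and a minimal face is
    wanted.\<close>
  define U where "U = {V. face (- V) \<and> - V \<subseteq> \<Phi>A}"
  have "\<exists>V\<in>U. \<forall>W\<in>U. V \<subseteq> W \<longrightarrow> W = V"
  proof (rule subset_Zorn_nonempty)
    show "U \<noteq> {}" using \<Phi>A by (auto simp: U_def intro!: exI[of _ "- \<Phi>A"])
    fix C assume C: "C \<noteq> {}" "subset.chain U C"
    have "face (\<Inter>(uminus ` C))"
    proof (rule face_Inter_chain)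
      show "uminus ` C \<noteq> {}" using C(1) by blast
      show "face \<Phi>" if "\<Phi> \<in> uminus ` C" for \<Phi> using C(2) that by (auto simp: U_def subset_chain_def)
      fix \<Phi> \<Psi> assume "\<Phi> \<in> uminus ` C" "\<Psi> \<in> uminus ` C"
      then have "- \<Phi> \<in> C" "- \<Psi> \<in> C" by auto
      then have "- \<Phi> \<subseteq> - \<Psi> \<or> - \<Psi> \<subseteq> - \<Phi>" using C(2) unfolding subset_chain_def by blast
      then show "\<Phi> \<subseteq> \<Psi> \<or> \<Psi> \<subseteq> \<Phi>" by (simp only: Compl_subset_Compl_iff) blast
    qed
    moreover have "\<Inter>(uminus ` C) = - \<Union>C" by auto
    moreover have "- \<Union>C \<subseteq> \<Phi>A" using C by (auto simp: U_def subset_chain_def)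
    ultimately show "\<Union>C \<in> U" by (simp add: U_def)
  qed
  then obtain V where V: "V \<in> U" "\<And>W. W \<in> U \<Longrightarrow> V \<subseteq> W \<Longrightarrow> W = V" by blast
  define \<Phi> where "\<Phi> = - V"
  have \<Phi>: "face \<Phi>" "\<Phi> \<subseteq> \<Phi>A" using V(1) by (auto simp: \<Phi>_def U_def)
  have min: "\<Psi> = \<Phi>" if "face \<Psi>" "\<Psi> \<subseteq> \<Phi>" for \<Psi>
  proof -
    have "- \<Psi> = V" using V(2)[of "- \<Psi>"] that \<Phi> by (auto simp: U_def \<Phi>_def)
    then show ?thesis by (auto simp: \<Phi>_def)
  qed
  obtain \<mu> where \<mu>: "\<mu> \<in> \<Phi>" using \<Phi>(1) by (auto simp: face_def)
  have "\<nu> = \<mu>" if "\<nu> \<in> \<Phi>" for \<nu>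
  proof
    fix E
    have "{\<mu>\<in>\<Phi>. \<forall>\<mu>'\<in>\<Phi>. \<mu>' E \<le> \<mu> E} = \<Phi>" by (rule min[OF face_maximizers[OF \<Phi>(1)]]) blast
    then have "\<forall>\<mu>'\<in>\<Phi>. \<mu>' E \<le> \<mu> E" "\<forall>\<mu>'\<in>\<Phi>. \<mu>' E \<le> \<nu> E" using \<mu> that by blast+
    then show "\<nu> E = \<mu> E" using \<mu> that by (blast intro: antisym)
  qed
  then have "\<Phi> = {\<mu>}" using \<mu> by blast
  then show ?thesis using \<Phi> face_singleton_ergodic dense by blast
qed

text \<open>Poincare recurrence: the translates by the first \<open>R\<close> multiples of
  \<open>e\<close> have total mean above 1, so two of them overlap in positive mean, and invariance
  leaves only the difference of their indices.\<close>

lemma exists_overlapping_multiple: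
  fixes Q :: "'a::ab_group_add set"
  assumes m: "mean \<mu>" and i: "invariant \<mu>" and "1 < real R * \<mu> Q"
  shows "\<exists>n>0. n \<le> R \<and> 0 < \<mu> (Q \<inter> shift (nmul n e) Q)"
proof (rule ccontr)
  assume neg: "\<not> ?thesis"
  have "(\<Sum>i<R. \<mu> (shift (nmul i e) Q)) \<le> 1"
  proof (rule mean_null_overlaps[OF m])
    fix i j :: nat assume ij: "i < j" "j < R"
    have "shift (nmul i e) Q \<inter> shift (nmul j e) Q = shift (nmul i e) (Q \<inter> shift (nmul (j - i) e) Q)"
      using ij nmul_add[of i "j - i" e] by (simp add: shift_Int)
    then have "\<mu> (shift (nmul i e) Q \<inter> shift (nmul j e) Q) = \<mu> (Q \<inter> shift (nmul (j - i) e) Q)"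
      by (simp only: invariant_shift[OF i])
    moreover have "\<not> 0 < \<mu> (Q \<inter> shift (nmul (j - i) e) Q)" 
    proof -
      have "0 < j - i" "j - i \<le> R" using ij by auto
      then show ?thesis using neg by blast
    qed
    ultimately show "\<mu> (shift (nmul i e) Q \<inter> shift (nmul j e) Q) = 0"
      using mean_nonneg[OF m, of "Q \<inter> shift (nmul (j - i) e) Q"] by linarith
  qed
  then show False using assms(3) by (simp add: invariant_shift[OF i])
qed

section \<open>Sumsets in divisible groups\<close>

text \<open>The translations with \<open>\<mu> (Q \<inter> shift e Q) > 0\<close> form a subgroup of finite index, which is everything
  because a divisible group has no proper subgroup of finite index.\<close>

lemma full_of_rigid:
  fixes Q :: "'a::ab_group_add set"
  assumes erg: "ergodic \<mu>" and div: "\<And>g n. 0 < n \<Longrightarrow> \<exists>h::'a. nmul n h = g"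
    and \<theta>: "0 < \<theta>" "2 * \<theta> < \<mu> Q"
    and rigid: "\<And>e. 0 < \<mu> (Q \<inter> shift e Q) \<Longrightarrow> \<mu> (Q - shift e Q) \<le> \<theta>"
  shows "\<mu> Q * (1 - \<mu> Q) \<le> 2 * \<theta>"
proof -
  have m: "mean \<mu>" and i: "invariant \<mu>" using erg by (auto simp: ergodic_def)
  define T where "T = {e. 0 < \<mu> (Q \<inter> shift e Q)}"
  \<comment> \<open>The part of \<open>Q\<close> lost under \<open>e + e'\<close> is at most the sum
    of the two separate losses, and \<open>2 * \<theta> < \<mu> Q\<close> leaves some
    overlap.\<close>
  have add: "e + e' \<in> T" if "e \<in> T" "e' \<in> T" for e e'
  proof -
    have "\<mu> (Q - shift (e + e') Q) \<le> \<mu> ((Q - shift e Q) \<union> shift e (Q - shift e' Q))"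
      by (rule mean_mono[OF m]) (auto simp: algebra_simps)
    also have "\<dots> \<le> \<mu> (Q - shift e Q) + \<mu> (shift e (Q - shift e' Q))"
      by (simp add: mean_Un[OF m] mean_mono[OF m])
    also have "\<dots> = \<mu> (Q - shift e Q) + \<mu> (Q - shift e' Q)" by (simp only: invariant_shift[OF i])
    also have "\<dots> \<le> 2 * \<theta>" using rigid[of e] rigid[of e'] that by (simp add: T_def)
    finally have "0 < \<mu> (Q \<inter> shift (e + e') Q)"
      using mean_split[OF m, of Q "shift (e + e') Q"] \<theta>(2) by simp
    then show ?thesis by (simp add: T_def)
  qed
  have nmul: "nmul n e \<in> T" if "e \<in> T" for n e
    using that \<theta> add by (induction n) (auto simp: T_def)
  have T: "e \<in> T" for e
  proof -
    obtain R :: nat where "1 / \<mu> Q < real R" using reals_Archimedean2 by blast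
    then have R: "1 < real R * \<mu> Q" using \<theta> by (simp add: field_simps)
    \<comment> \<open>Dividing by \<open>fact R\<close> makes \<open>e\<close> a multiple of
      \<open>nmul n e0\<close> for whichever recurrence time \<open>n \<le> R\<close> turns
      up.\<close>
    obtain e0 where e0: "nmul (fact R) e0 = e" using div[of "fact R" e] by auto
    obtain n where n: "0 < n" "n \<le> R" "nmul n e0 \<in> T"
      using exists_overlapping_multiple[OF m i R, of e0] by (auto simp: T_def)
    then have "n dvd fact R" by (simp add: dvd_fact)
    then obtain q where "fact R = q * n" by (metis dvd_def mult.commute)
    then have "e = nmul q (nmul n e0)" using e0 by (simp add: nmul_mult)
    then show ?thesis using nmul n(3) by simp
  qed
  obtain fs where fs: "fs \<noteq> []" and avg: "\<And>h. \<bar>(\<Sum>f\<leftarrow>fs. \<mu> (Q \<inter> shift (h + f) Q)) - real (length fs) * (\<mu> Q * \<mu> Q)\<bar>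
    \<le> \<theta> * real (length fs)" using ergodic_average[OF erg \<theta>(1), of Q Q] by blast
  \<comment> \<open>By ergodicity the average overlap is near \<open>\<mu> Q * \<mu> Q\<close>, yet
    every single overlap is at least \<open>\<mu> Q - \<theta>\<close>.\<close>
  have "(\<Sum>f\<leftarrow>fs. \<mu> Q - \<theta>) \<le> (\<Sum>f\<leftarrow>fs. \<mu> (Q \<inter> shift (0 + f) Q))"
  proof (intro sum_list_mono)
    fix f
    show "\<mu> Q - \<theta> \<le> \<mu> (Q \<inter> shift (0 + f) Q)"
      using rigid[of f] T[of f] mean_split[OF m, of Q "shift f Q"] by (simp add: T_def)
  qed
  then have "real (length fs) * (\<mu> Q - \<theta>) \<le> real (length fs) * (\<mu> Q * \<mu> Q + \<theta>)"
    using avg[of 0] by (simp add: sum_list_triv algebra_simps)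
  then have "\<mu> Q - \<theta> \<le> \<mu> Q * \<mu> Q + \<theta>"
    by (rule mult_left_le_imp_le) (use fs in simp)
  then show ?thesis by (simp add: algebra_simps)
qed

section \<open>Pairs of sets with disjoint translates\<close>

text \<open>Exchanging the two sets of a pair with disjoint translates replaces \<open>A\<close> by
  its negative, so bounds for one set carry over to the other.\<close>

lemma banach_density_ge_uminus:
  assumes "banach_density_ge \<delta> A"
  shows "banach_density_ge \<delta> {x. - x \<in> A}"
  unfolding banach_density_ge_def
proof (intro allI impI)
  fix fs :: "'a list" assume "fs \<noteq> []"
  then obtain h where h: "\<delta> * real (length (map uminus fs)) \<le> (\<Sum>f\<leftarrow>map uminus fs. indicat_real A (h + f))"
    using assms unfolding banach_density_ge_def by (metis map_is_Nil_conv)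
  have "indicat_real {x. - x \<in> A} (- h + f) = indicat_real A (h + - f)" for f
    by (simp add: indicator_def)
  then show "\<exists>h. \<delta> * real (length fs) \<le> (\<Sum>f\<leftarrow>fs. indicat_real {x. - x \<in> A} (h + f))"
    using h by (intro exI[of _ "- h"]) (simp add: comp_def)
qed

text \<open>Move an averaging window to where a proportion \<delta> of it lies in \<open>A\<close>:
  those translates contribute nothing and the others at most \<open>\<mu> F\<close>, while the
  average is nearly \<open>\<mu> F * \<mu> E\<close>.\<close>

lemma mean_le_of_disjoint_shifts:
  assumes erg: "ergodic \<mu>" and dens: "banach_density_ge \<delta> A"
    and disj: "\<And>g. g \<in> A \<Longrightarrow> F \<inter> shift g E = {}" and pos: "0 < \<mu> F"
  shows "\<mu> E \<le> 1 - \<delta>"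
proof -
  have m: "mean \<mu>" using erg by (simp add: ergodic_def)
  have "\<mu> F * \<mu> E \<le> \<mu> F * (1 - \<delta>)"
  proof (rule field_le_epsilon)
    fix \<epsilon> :: real assume "0 < \<epsilon>"
    then obtain fs where fs: "fs \<noteq> []" and avg: "\<And>h. \<bar>(\<Sum>f\<leftarrow>fs. \<mu> (F \<inter> shift (h + f) E))
        - real (length fs) * (\<mu> F * \<mu> E)\<bar> \<le> \<epsilon> * real (length fs)"
      using ergodic_average[OF erg, of \<epsilon> F E] by blast
    obtain h where h: "\<delta> * real (length fs) \<le> (\<Sum>f\<leftarrow>fs. indicat_real A (h + f))"
      using dens fs unfolding banach_density_ge_def by blast
    have "(\<Sum>f\<leftarrow>fs. \<mu> (F \<inter> shift (h + f) E)) \<le> (\<Sum>f\<leftarrow>fs. \<mu> F - \<mu> F * indicat_real A (h + f))"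
      by (intro sum_list_mono) (auto simp: indicator_def disj mean_empty[OF m] intro: mean_mono[OF m])
    also have "\<dots> = \<mu> F * (real (length fs) - (\<Sum>f\<leftarrow>fs. indicat_real A (h + f)))"
      by (simp add: sum_list_subtractf sum_list_const_mult sum_list_triv algebra_simps)
    also have "\<dots> \<le> \<mu> F * (real (length fs) - \<delta> * real (length fs))"
      using pos h by (intro mult_left_mono) auto
    finally have "real (length fs) * (\<mu> F * \<mu> E) \<le> real (length fs) * (\<mu> F * (1 - \<delta>) + \<epsilon>)"
      using avg[of h] by (simp add: algebra_simps)
    then show "\<mu> F * \<mu> E \<le> \<mu> F * (1 - \<delta>) + \<epsilon>" using fs by simp
  qed
  then show ?thesis using pos by simp
qed

text \<open>The two transforms of a pair \<open>(P, Q)\<close> used below send the values \<open>(p, q)\<close> to \<open>(p + a, q - b)\<close> and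
  \<open>(p - a, q + b)\<close>. Strict convexity of the energy forces \<open>a\<close> and \<open>b\<close> to be small at a
  nearly maximal pair, while for small \<open>c\<close> such a pair still nearly maximises \<open>p + q\<close>.\<close>

definition energy :: "real \<Rightarrow> real \<Rightarrow> real \<Rightarrow> real" where
  "energy c x z = x + z + c * (x\<^sup>2 + z\<^sup>2)"

lemma energy_commute: "energy c x z = energy c z x"
  by (simp add: energy_def)

text \<open>The energies of the two transformed pairs add up to twice the old energy plus
  \<open>2 * (c * (a\<^sup>2 + b\<^sup>2))\<close>, which near-maximality bounds. Rigidity is
  obtained for the set of smaller mean.\<close>

lemma rigid_of_near_maximal:
  fixes P Q :: "'a::ab_group_add set"
  assumes m: "mean \<mu>" and i: "invariant \<mu>" and c: "0 < c" and \<theta>: "0 < \<theta>" "\<theta> < \<mu> Q" and "\<mu> Q \<le> \<mu> P"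
    and bd1: "0 < \<mu> (Q \<inter> shift e Q) \<Longrightarrow> energy c (\<mu> (P \<union> shift e P)) (\<mu> (Q \<inter> shift e Q)) \<le> M"
    and bd2: "0 < \<mu> (P \<inter> shift e P) \<Longrightarrow> energy c (\<mu> (P \<inter> shift e P)) (\<mu> (Q \<union> shift e Q)) \<le> M"
    and near: "M - c * \<theta>\<^sup>2 < energy c (\<mu> P) (\<mu> Q)"
    and over: "0 < \<mu> (Q \<inter> shift e Q)"
  shows "\<mu> (Q - shift e Q) \<le> \<theta>"
proof -
  define gain where "gain E = \<mu> (E - shift e E)" for E :: "'a set"
  have Int: "\<mu> (E \<inter> shift e E) = \<mu> E - gain E" for E
    using mean_split[OF m, of E "shift e E"] by (simp add: gain_def)
  have Un: "\<mu> (E \<union> shift e E) = \<mu> E + gain E" for E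
    using mean_split[OF m, of "shift e E" E] Int[of E]
    by (simp add: mean_Un[OF m] invariant_shift[OF i] Int_commute)
  have g0: "0 \<le> gain E" for E by (simp add: gain_def mean_nonneg[OF m])
  define p q a b where "p = \<mu> P" "q = \<mu> Q" "a = gain P" "b = gain Q"
  note defs = this
  have 1: "energy c (p + a) (q - b) \<le> M" using bd1[OF over] by (simp add: defs Int Un)
  have near': "M < energy c p q + c * \<theta>\<^sup>2" using near by (simp add: defs)
  have q: "\<theta> < q" "q \<le> p" "0 \<le> b" "b \<le> q" using assms over g0[of Q] by (simp_all add: defs Int)
  \<comment> \<open>The second transform is available only if \<open>P\<close> meets its translate
    in positive mean. Otherwise the first transform doubles \<open>P\<close>, and
    \<open>q \<le> p\<close> pushes its energy above \<open>M\<close>.\<close>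
  have "a < p"
  proof (rule ccontr)
    assume "\<not> a < p"
    then have "a = p" using Int[of P] mean_nonneg[OF m, of "P \<inter> shift e P"] by (simp add: defs)
    then have "p + q + (p - b) + c * (4 * p\<^sup>2 + (q - b)\<^sup>2) < p + q + c * (p\<^sup>2 + q\<^sup>2 + \<theta>\<^sup>2)"
      using 1 near' by (simp add: energy_def power2_eq_square algebra_simps)
    moreover have "c * (p\<^sup>2 + q\<^sup>2 + \<theta>\<^sup>2) \<le> c * (4 * p\<^sup>2 + (q - b)\<^sup>2)"
    proof (intro mult_left_mono)
      have "q\<^sup>2 \<le> p\<^sup>2" "\<theta>\<^sup>2 \<le> p\<^sup>2" using q \<theta> by (auto intro: power_mono)
      then show "p\<^sup>2 + q\<^sup>2 + \<theta>\<^sup>2 \<le> 4 * p\<^sup>2 + (q - b)\<^sup>2"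
        using zero_le_power2[of p] zero_le_power2[of "q - b"] by linarith
    qed (use c in simp)
    ultimately show False using q by linarith
  qed
  then have "energy c (p - a) (q + b) \<le> M" using bd2 by (simp add: defs Int Un)
  moreover have "energy c (p + a) (q - b) + energy c (p - a) (q + b) = 2 * energy c p q + 2 * (c * (a\<^sup>2 + b\<^sup>2))"
    by (simp add: energy_def power2_eq_square algebra_simps)
  ultimately have "c * (a\<^sup>2 + b\<^sup>2) < c * \<theta>\<^sup>2" using 1 near' by linarith
  then have "a\<^sup>2 + b\<^sup>2 < \<theta>\<^sup>2" using c by simp
  then have "b\<^sup>2 \<le> \<theta>\<^sup>2" using zero_le_power2[of a] by linarith
  then have "b \<le> \<theta>" by (rule power2_le_imp_le) (use \<theta> in simp)
  then show ?thesis by (simp add: defs gain_def)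
qed

text \<open>A point of the union comes from the set or from its translate; the intersection on the
  other side serves both cases, by testing disjointness at \<open>x\<close> or at
  \<open>x - e\<close>.\<close>

lemma disjoint_shift_transform:
  assumes "Q \<inter> shift g P = {}"
  shows "Q \<inter> shift e Q \<inter> shift g (P \<union> shift e P) = {}"
    and "(Q \<union> shift e Q) \<inter> shift g (P \<inter> shift e P) = {}"
proof -
  have *: "x - g \<notin> P" if "x \<in> Q" for x using assms that by auto
  have eq: "x - g - e = x - e - g" for x by (simp add: algebra_simps)
  show "Q \<inter> shift e Q \<inter> shift g (P \<union> shift e P) = {}"
    "(Q \<union> shift e Q) \<inter> shift g (P \<inter> shift e P) = {}"
    by (auto simp: eq dest: *)
qed

text \<open>The Kneser-type inequality in symmetric form. A counterexample yields a near-maximiser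
  of the energy whose smaller set is rigid, hence nearly null or nearly full, although its mean
  stays away from 0 and 1.\<close>

lemma mean_sum_le_of_disjoint_shifts:
  fixes X Z :: "'a::ab_group_add set"
  assumes erg: "ergodic \<mu>" and div: "\<And>g n. 0 < n \<Longrightarrow> \<exists>h::'a. nmul n h = g"
    and dens: "banach_density_ge \<delta> A" and \<delta>: "0 < \<delta>"
    and disj: "\<And>g. g \<in> A \<Longrightarrow> Z \<inter> shift g X = {}" and pos: "0 < \<mu> X" "0 < \<mu> Z"
  shows "\<mu> X + \<mu> Z \<le> 1 - \<delta>"
proof (rule ccontr)
  assume neg: "\<not> ?thesis"
  have m: "mean \<mu>" and i: "invariant \<mu>" using erg by (auto simp: ergodic_def)
  \<comment> \<open>Positivity is kept in the class because the bound \<open>1 - \<delta>\<close> on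
    each mean depends on the other being positive.\<close>
  define G where "G = {(X, Z). (\<forall>g\<in>A. Z \<inter> shift g X = {}) \<and> 0 < \<mu> X \<and> 0 < \<mu> Z}"
  have le: "\<mu> X \<le> 1 - \<delta>" "\<mu> Z \<le> 1 - \<delta>" if "(X, Z) \<in> G" for X Z
  proof -
    show "\<mu> X \<le> 1 - \<delta>"
      using that by (intro mean_le_of_disjoint_shifts[OF erg dens, of Z]) (auto simp: G_def)
    show "\<mu> Z \<le> 1 - \<delta>"
      using that
      by (intro mean_le_of_disjoint_shifts[OF erg banach_density_ge_uminus[OF dens], of X])
        (force simp: G_def)+
  qed
  \<comment> \<open>Half the excess. With \<open>c = \<kappa> / 4\<close> the quadratic part of the
    energy is at most \<open>\<kappa> / 2\<close> and the defect \<open>c * \<theta>\<^sup>2\<close>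
    at most \<open>\<kappa> / 4\<close>, so a near-maximal pair keeps an excess above \<kappa>;
    \<theta> is chosen to make \<open>2 * \<theta> < \<kappa> * \<delta>\<close>.\<close>
  define \<kappa> where "\<kappa> = (\<mu> X + \<mu> Z - (1 - \<delta>)) / 2"
  define c where "c = \<kappa> / 4"
  define \<theta> where "\<theta> = \<kappa> * \<delta> / 8"
  have XZ: "(X, Z) \<in> G" using disj pos by (auto simp: G_def)
  have \<kappa>: "0 < \<kappa>" using neg by (simp add: \<kappa>_def)
  have \<delta>1: "\<delta> \<le> 1" using le[OF XZ] pos by simp
  have \<kappa>1: "\<kappa> \<le> 1" using le[OF XZ] \<delta> \<delta>1 by (simp add: \<kappa>_def)
  have c: "0 < c" and \<theta>: "0 < \<theta>" using \<kappa> \<delta> by (auto simp: c_def \<theta>_def)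
  have \<theta>8: "\<theta> \<le> \<kappa> / 8" using mult_left_mono[OF \<delta>1, of \<kappa>] \<kappa> by (simp add: \<theta>_def)
  have c\<theta>: "c * \<theta>\<^sup>2 \<le> \<kappa> / 4"
  proof -
    have "\<theta>\<^sup>2 \<le> 1" using \<theta> \<theta>8 \<kappa>1 by (simp add: power_le_one)
    then show ?thesis using mult_left_mono[of "\<theta>\<^sup>2" 1 c] c by (simp add: c_def)
  qed
  define V where "V = (\<lambda>(X, Z). energy c (\<mu> X) (\<mu> Z)) ` G"
  have energy_le: "energy c (\<mu> X) (\<mu> Z) \<le> \<mu> X + \<mu> Z + 2 * c" for X Z
  proof -
    have "(\<mu> X)\<^sup>2 + (\<mu> Z)\<^sup>2 \<le> 2"
      using power_le_one[OF mean_nonneg[OF m] mean_le_1[OF m], of X 2]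
        power_le_one[OF mean_nonneg[OF m] mean_le_1[OF m], of Z 2] by linarith
    then show ?thesis using mult_left_mono[of _ 2 c] c by (simp add: energy_def mult.commute)
  qed
  have bdd: "bdd_above V"
  proof (rule bdd_aboveI)
    fix v assume "v \<in> V"
    then obtain X Z where "v = energy c (\<mu> X) (\<mu> Z)" by (auto simp: V_def)
    then show "v \<le> 2 + 2 * c"
      using energy_le[of X Z] mean_le_1[OF m, of X] mean_le_1[OF m, of Z] by simp
  qed
  define M where "M = Sup V"
  have M: "energy c (\<mu> X) (\<mu> Z) \<le> M" if "(X, Z) \<in> G" for X Z
    unfolding M_def V_def using that by (intro cSup_upper bdd[unfolded V_def]) auto
  have "\<exists>v\<in>V. M - c * \<theta>\<^sup>2 < v"
    unfolding M_def using XZ c \<theta> bdd by (intro less_cSupD) (auto simp: V_def)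
  then obtain P Q where PQ: "(P, Q) \<in> G" and near: "M - c * \<theta>\<^sup>2 < energy c (\<mu> P) (\<mu> Q)"
    by (auto simp: V_def)
  have "\<mu> X + \<mu> Z \<le> energy c (\<mu> X) (\<mu> Z)" using c by (simp add: energy_def)
  then have "\<mu> X + \<mu> Z < \<mu> P + \<mu> Q + 2 * c + c * \<theta>\<^sup>2"
    using M[OF XZ] near energy_le[of P Q] by linarith
  then have sum: "1 - \<delta> + \<kappa> < \<mu> P + \<mu> Q" using c\<theta> \<kappa> by (simp add: c_def \<kappa>_def field_simps)
  have large: "\<kappa> < \<mu> P" "\<kappa> < \<mu> Q" using sum le[OF PQ] by auto
  \<comment> \<open>The mean of \<open>R\<close> lies between \<kappa> and
    \<open>1 - \<delta>\<close>, so \<open>\<mu> R * (1 - \<mu> R)\<close> is at least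
    \<open>\<kappa> * \<delta>\<close>, while rigidity allows only
    \<open>2 * \<theta>\<close>.\<close>
  have contra: False
    if R: "R = P \<or> R = Q" and rigid: "\<And>e. 0 < \<mu> (R \<inter> shift e R) \<Longrightarrow> \<mu> (R - shift e R) \<le> \<theta>" for R
  proof -
    have R: "\<kappa> < \<mu> R" "\<mu> R \<le> 1 - \<delta>" using R large le[OF PQ] by auto
    have "\<mu> R * (1 - \<mu> R) \<le> 2 * \<theta>"
      using R \<theta>8 \<kappa> by (intro full_of_rigid[OF erg div \<theta> _ rigid]) auto
    moreover have "\<kappa> * \<delta> \<le> \<mu> R * (1 - \<mu> R)"
      using R \<kappa> \<delta> by (intro mult_mono) auto
    ultimately show False using \<theta> unfolding \<theta>_def by linarith
  qed
  have G1: "(P \<union> shift e P, Q \<inter> shift e Q) \<in> G" if "0 < \<mu> (Q \<inter> shift e Q)" for e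
  proof -
    have "(Q \<inter> shift e Q) \<inter> shift g (P \<union> shift e P) = {}" if "g \<in> A" for g
      using PQ that by (intro disjoint_shift_transform) (auto simp: G_def)
    moreover have "\<mu> P \<le> \<mu> (P \<union> shift e P)" by (rule mean_mono[OF m]) auto
    ultimately show ?thesis using that large \<kappa> by (auto simp: G_def)
  qed
  have G2: "(P \<inter> shift e P, Q \<union> shift e Q) \<in> G" if "0 < \<mu> (P \<inter> shift e P)" for e
  proof -
    have "(Q \<union> shift e Q) \<inter> shift g (P \<inter> shift e P) = {}" if "g \<in> A" for g
      using PQ that by (intro disjoint_shift_transform) (auto simp: G_def)
    moreover have "\<mu> Q \<le> \<mu> (Q \<union> shift e Q)" by (rule mean_mono[OF m]) auto
    ultimately show ?thesis using that large \<kappa> by (auto simp: G_def)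
  qed
  have \<theta>PQ: "\<theta> < \<mu> P" "\<theta> < \<mu> Q" using large \<theta>8 \<kappa> by auto
  show False
  proof (cases "\<mu> Q \<le> \<mu> P")
    case True
    have "\<mu> (Q - shift e Q) \<le> \<theta>" if "0 < \<mu> (Q \<inter> shift e Q)" for e
      by (rule rigid_of_near_maximal[OF m i c \<theta> \<theta>PQ(2) True M[OF G1] M[OF G2] near that])
    then show False by (rule contra[OF disjI2[OF refl]])
  next
    case False
    then have PQ_le: "\<mu> P \<le> \<mu> Q" by simp
    \<comment> \<open>The energy is symmetric, so when \<open>P\<close> is the smaller set the two
      transforms exchange roles.\<close>
    note swap = energy_commute[THEN ord_eq_le_trans]
    have "M - c * \<theta>\<^sup>2 < energy c (\<mu> Q) (\<mu> P)" using near by (simp only: energy_commute[of c "\<mu> P"])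
    note * = rigid_of_near_maximal[OF m i c \<theta> \<theta>PQ(1) PQ_le swap[OF M[OF G2]] swap[OF M[OF G1]] this]
    have "\<mu> (P - shift e P) \<le> \<theta>" if "0 < \<mu> (P \<inter> shift e P)" for e
      by (rule *[OF _ _ that])
    then show False by (rule contra[OF disjI1[OF refl]])
  qed
qed

section \<open>Growth of iterated sumsets\<close>

definition sumset :: "nat \<Rightarrow> 'a::ab_group_add set \<Rightarrow> 'a set" where
  "sumset n A = {\<Sum>i<n. x i | x. \<forall>i<n. x i \<in> A}"

text \<open>The complement of the next sumset avoids every translate of the current one by an
  element of \<open>A\<close>, so the bound for pairs gives a gain of \<delta> per summand.\<close>

lemma mean_sumset_ge:
  fixes A :: "'a::ab_group_add set"
  assumes erg: "ergodic \<mu>" and div: "\<And>g n. 0 < n \<Longrightarrow> \<exists>h::'a. nmul n h = g"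
    and dens: "banach_density_ge \<delta> A" and \<delta>: "0 < \<delta>" "\<delta> \<le> \<mu> A" and "0 < n"
  shows "min 1 (real n * \<delta>) \<le> \<mu> (sumset n A)"
  using \<open>0 < n\<close>
proof (induction n rule: nat_induct_non_zero)
  case 1
  have "a \<in> sumset 1 A \<longleftrightarrow> a \<in> A" for a
    using exI[of "\<lambda>x. a = x 0 \<and> x 0 \<in> A" "\<lambda>_::nat. a"] by (auto simp: sumset_def)
  then have "sumset 1 A = A" by blast
  then show ?case using \<delta> by simp
next
  case (Suc n)
  have m: "mean \<mu>" using erg by (simp add: ergodic_def)
  define Z where "Z = - sumset (Suc n) A"
  have disj: "Z \<inter> shift g (sumset n A) = {}" if "g \<in> A" for g
  proof -
    have "z \<in> sumset (Suc n) A" if z: "z - g \<in> sumset n A" for z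
    proof -
      obtain x where x: "z - g = (\<Sum>i<n. x i)" "\<forall>i<n. x i \<in> A" using z unfolding sumset_def by blast
      have "z = (\<Sum>i<Suc n. (x(n := g)) i)" using x(1) by (simp add: algebra_simps)
      moreover have "\<forall>i<Suc n. (x(n := g)) i \<in> A" using x(2) \<open>g \<in> A\<close> by auto
      ultimately show ?thesis unfolding sumset_def by blast
    qed
    then show ?thesis by (auto simp: Z_def)
  qed
  have "0 < real n * \<delta>" using Suc.hyps \<delta> by simp
  then have pos: "0 < \<mu> (sumset n A)" using Suc.IH by linarith
  have Z: "\<mu> Z = 1 - \<mu> (sumset (Suc n) A)" by (simp add: Z_def mean_Compl[OF m])
  show ?case
  \<comment> \<open>A null complement means that the sumset has full mean, where the minimum is
    capped at 1.\<close>
  proof (cases "\<mu> Z = 0")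
    case True
    then show ?thesis using Z by simp
  next
    case False
    then have Zpos: "0 < \<mu> Z" using mean_nonneg[OF m, of Z] by simp
    have *: "\<mu> (sumset n A) + \<mu> Z \<le> 1 - \<delta>"
      by (rule mean_sum_le_of_disjoint_shifts[OF erg div dens \<delta>(1) disj pos Zpos])
    then have "\<mu> (sumset n A) < 1" using Zpos \<delta> by linarith
    then have "real n * \<delta> \<le> \<mu> (sumset n A)" using Suc.IH by linarith
    then show ?thesis using * Z by (simp add: algebra_simps)
  qed
qed

theorem banach_density_sum_free:
  fixes A :: "'a::ab_group_add set"
  assumes div: "\<And>g n. 0 < n \<Longrightarrow> \<exists>h::'a. nmul n h = g"
    and dens: "banach_density_ge \<delta> A" and kl: "0 < k" "0 < l"
    and free: "sumset k A \<inter> sumset l A = {}"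
  shows "\<delta> \<le> 1 / real (k + l)"
proof (cases "0 < \<delta>")
  case True
  obtain \<mu> where erg: "ergodic \<mu>" and \<delta>: "\<delta> \<le> \<mu> A"
    using ergodic_mean_of_dense[OF dens] by blast
  have m: "mean \<mu>" using erg by (simp add: ergodic_def)
  have k: "min 1 (real k * \<delta>) \<le> \<mu> (sumset k A)" and l: "min 1 (real l * \<delta>) \<le> \<mu> (sumset l A)"
    using mean_sumset_ge[OF erg div dens True \<delta>] kl by auto
  \<comment> \<open>Since both are positive, neither minimum can be 1: the disjoint sumsets would
    have total mean above 1.\<close>
  have "0 < real k * \<delta>" "0 < real l * \<delta>" using kl True by auto
  then have "real k * \<delta> + real l * \<delta> \<le> 1"
    using k l mean_disjoint_le_1[OF m free] by (auto simp: min_def split: if_splits)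
  then show ?thesis using kl by (simp add: field_simps)
next
  case False
  then show ?thesis by (auto intro: order_trans[of \<delta> 0])
qed

section \<open>Transfer to the integers\<close>

text \<open>Rational values, rather than integer ones, make this group divisible on the nose.\<close>

typedef divseq = "{f :: nat \<Rightarrow> rat. \<forall>q>0. \<forall>\<^sub>F N in sequentially. f N / of_nat q \<in> \<int>}"
  morphisms seq Abs_divseq
  by (intro exI[of _ "\<lambda>_. 0"]) simp

setup_lifting type_definition_divseq

instantiation divseq :: ab_group_add
begin

lift_definition zero_divseq :: divseq is "\<lambda>_. 0" by simp

lift_definition plus_divseq :: "divseq \<Rightarrow> divseq \<Rightarrow> divseq" is "\<lambda>f g N. f N + g N"
proof -
  fix f g :: "nat \<Rightarrow> rat" and q :: nat
  assume "\<And>q. 0 < q \<Longrightarrow> \<forall>\<^sub>F N in sequentially. f N / of_nat q \<in> \<int>"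
    "\<And>q. 0 < q \<Longrightarrow> \<forall>\<^sub>F N in sequentially. g N / of_nat q \<in> \<int>" and "0 < q"
  then have "\<forall>\<^sub>F N in sequentially. f N / of_nat q \<in> \<int>" "\<forall>\<^sub>F N in sequentially. g N / of_nat q \<in> \<int>"
    by auto
  then show "\<forall>\<^sub>F N in sequentially. (f N + g N) / of_nat q \<in> \<int>"
    by eventually_elim (simp add: add_divide_distrib)
qed

lift_definition uminus_divseq :: "divseq \<Rightarrow> divseq" is "\<lambda>f N. - f N" by simp

definition minus_divseq :: "divseq \<Rightarrow> divseq \<Rightarrow> divseq" where
  "minus_divseq f g = f + - g"

instance
  by standard (simp_all add: minus_divseq_def, (transfer, simp add: ac_simps)+)

end

lemma seq_nmul: "seq (nmul n f) N = of_nat n * seq f N"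
  by (induction n) (simp_all add: zero_divseq.rep_eq plus_divseq.rep_eq algebra_simps)

lemma seq_sum: "seq (\<Sum>i\<in>I. x i) N = (\<Sum>i\<in>I. seq (x i) N)"
  by (induction I rule: infinite_finite_induct) (simp_all add: zero_divseq.rep_eq plus_divseq.rep_eq)

text \<open>The termwise quotient is eventually divisible by \<open>q\<close> because
  \<open>g\<close> is eventually divisible by \<open>n * q\<close>.\<close>

lemma divseq_divisible:
  assumes "0 < n"
  shows "\<exists>h. nmul n h = (g :: divseq)"
proof -
  have "(\<lambda>N. seq g N / of_nat n) \<in> {f. \<forall>q>0. \<forall>\<^sub>F N in sequentially. f N / of_nat q \<in> \<int>}"
  proof (intro CollectI allI impI)
    fix q :: nat assume "0 < q"
    then have "\<forall>\<^sub>F N in sequentially. seq g N / of_nat (n * q) \<in> \<int>"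
      using seq[of g] assms by (auto simp del: of_nat_mult)
    then show "\<forall>\<^sub>F N in sequentially. seq g N / of_nat n / of_nat q \<in> \<int>" by simp
  qed
  then have "seq (Abs_divseq (\<lambda>N. seq g N / of_nat n)) = (\<lambda>N. seq g N / of_nat n)"
    by (rule Abs_divseq_inverse)
  then have "seq (nmul n (Abs_divseq (\<lambda>N. seq g N / of_nat n))) = seq g"
    using assms by (simp add: seq_nmul fun_eq_iff)
  then show ?thesis by (auto simp: seq_inject)
qed

text \<open>Plays the role of an ultrafilter limit of the sets \<open>B N\<close>.\<close>

lemma cluster_set:
  fixes B :: "nat \<Rightarrow> 'a set"
  shows "\<exists>A. \<forall>F N0. finite F \<longrightarrow> (\<exists>N\<ge>N0. \<forall>y\<in>F. y \<in> A \<longleftrightarrow> y \<in> B N)"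
proof -
  define u where "u N = indicat_real (B N)" for N
  have "eventually (\<lambda>f. f \<in> {f :: 'a \<Rightarrow> real. \<forall>x. f x \<in> {0..1}}) (filtermap u sequentially)"
    by (simp add: eventually_filtermap u_def)
  moreover have "filtermap u sequentially \<noteq> bot" by (simp add: filtermap_bot_iff)
  ultimately obtain x where x: "inf (nhds x) (filtermap u sequentially) \<noteq> bot"
    using compact_unit_cube[where 'a='a] unfolding compact_filter by blast
  \<comment> \<open>Rounding at 1/2: an indicator within less than 1/2 of the cluster point at
    \<open>y\<close> agrees with \<open>A\<close> there.\<close>
  define A where "A = {y. 1 / 2 < x y}"
  have "\<exists>N\<ge>N0. \<forall>y\<in>F. y \<in> A \<longleftrightarrow> y \<in> B N" if "finite F" for F N0
  proof (rule ccontr)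
    assume neg: "\<not> ?thesis"
    have "open (\<Inter>y\<in>F. {f. \<bar>f y - x y\<bar> < 1 / 2})"
      using \<open>finite F\<close> by (intro open_INT ballI open_Collect_less continuous_intros
          continuous_on_product_coordinates)
    then have "eventually (\<lambda>f. f \<in> (\<Inter>y\<in>F. {f. \<bar>f y - x y\<bar> < 1 / 2})) (nhds x)"
      by (rule eventually_nhds_in_open) simp
    moreover have "eventually (\<lambda>f. f \<notin> (\<Inter>y\<in>F. {f. \<bar>f y - x y\<bar> < 1 / 2})) (filtermap u sequentially)"
      unfolding eventually_filtermap
    proof (rule eventually_sequentiallyI[of N0])
      fix N assume "N0 \<le> N"
      then obtain y where "y \<in> F" "y \<in> A \<longleftrightarrow> y \<notin> B N" using neg by blast
      then show "u N \<notin> (\<Inter>y\<in>F. {f. \<bar>f y - x y\<bar> < 1 / 2})"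
        by (intro notI, elim INT_E[where a=y]) (auto simp: u_def A_def indicator_def split: if_splits)
    qed
    ultimately have "eventually (\<lambda>_. False) (inf (nhds x) (filtermap u sequentially))"
      unfolding eventually_inf by blast
    then show False using x by (simp add: trivial_limit_def)
  qed
  then show ?thesis by blast
qed

section \<open>Counting translates in the integers\<close>

lemma card_int_shift_le:
  fixes I :: "int set"
  shows "card (I \<inter> {1..n}) \<le> card (I \<inter> {1 + z..n + z}) + nat \<bar>z\<bar>"
proof -
  have "I \<inter> {1..n} \<subseteq> (I \<inter> {1 + z..n + z}) \<union> ({1..z} \<union> {n + z + 1..n})" by auto
  then have "card (I \<inter> {1..n}) \<le> card ((I \<inter> {1 + z..n + z}) \<union> ({1..z} \<union> {n + z + 1..n}))"
    by (intro card_mono) auto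
  also have "\<dots> \<le> card (I \<inter> {1 + z..n + z}) + (card {1..z} + card {n + z + 1..n})"
    by (intro order_trans[OF card_Un_le] add_left_mono card_Un_le)
  also have "card {1..z} + card {n + z + 1..n} = nat \<bar>z\<bar>" by auto
  finally show ?thesis .
qed

text \<open>Average the window sum over \<open>j\<close> in \<open>{1..int n}\<close>. Each offset
  costs at most its absolute value, a total that the slack \<open>\<delta>0 - \<delta>\<close>
  absorbs once \<open>n\<close> is large.\<close>

lemma exists_dense_translate:
  fixes I :: "int set" and zs :: "int list"
  assumes "zs \<noteq> []" "\<delta> < \<delta>0"
    and dens: "\<And>n0. \<exists>n\<ge>n0. 0 < n \<and> \<delta>0 * real n < real (card (I \<inter> {1..int n}))"
  shows "\<exists>j. \<delta> * real (length zs) \<le> (\<Sum>z\<leftarrow>zs. indicat_real I (j + z))"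
proof -
  define C where "C = (\<Sum>z\<leftarrow>zs. real (nat \<bar>z\<bar>))"
  define n0 where "n0 = nat \<lceil>C / ((\<delta>0 - \<delta>) * real (length zs))\<rceil>"
  obtain n where n: "n0 \<le> n" "0 < n" "\<delta>0 * real n < real (card (I \<inter> {1..int n}))"
    using dens by blast
  have pos: "0 < (\<delta>0 - \<delta>) * real (length zs)" using assms by simp
  have "C / ((\<delta>0 - \<delta>) * real (length zs)) \<le> real n" using n(1) unfolding n0_def by linarith
  then have C: "C \<le> real n * ((\<delta>0 - \<delta>) * real (length zs))" using pos by (simp add: pos_divide_le_eq)
  have count: "(\<Sum>j\<in>{1..int n}. indicat_real I (j + z)) = real (card (I \<inter> {1 + z..int n + z}))" for z
  proof -
    have "(\<Sum>j\<in>{1..int n}. indicat_real I (j + z)) = (\<Sum>j\<in>{1 + z..int n + z}. indicat_real I j)"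
      by (rule sum.reindex_bij_witness[of _ "\<lambda>j. j - z" "\<lambda>j. j + z"]) auto
    then show ?thesis by (simp add: indicator_def sum.If_cases Int_commute)
  qed
  have swap: "(\<Sum>j\<in>J. \<Sum>z\<leftarrow>zs. f j z) = (\<Sum>z\<leftarrow>zs. \<Sum>j\<in>J. f j z)" for J :: "int set" and f :: "int \<Rightarrow> int \<Rightarrow> real"
    by (induction zs) (simp_all add: sum.distrib)
  have "real n * (\<delta> * real (length zs)) \<le> real n * (\<delta>0 * real (length zs)) - C"
    using C by (simp add: algebra_simps)
  also have "\<dots> = (\<Sum>z\<leftarrow>zs. \<delta>0 * real n - real (nat \<bar>z\<bar>))"
    by (simp add: C_def sum_list_subtractf sum_list_triv)
  also have "\<dots> \<le> (\<Sum>z\<leftarrow>zs. \<Sum>j\<in>{1..int n}. indicat_real I (j + z))"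
  proof (intro sum_list_mono)
    fix z
    have "real (card (I \<inter> {1..int n})) \<le> real (card (I \<inter> {1 + z..int n + z})) + real (nat \<bar>z\<bar>)"
      using card_int_shift_le[of I "int n" z] by linarith
    then show "\<delta>0 * real n - real (nat \<bar>z\<bar>) \<le> (\<Sum>j\<in>{1..int n}. indicat_real I (j + z))"
      unfolding count using n(3) by linarith
  qed
  also have "\<dots> = (\<Sum>j\<in>{1..int n}. \<Sum>z\<leftarrow>zs. indicat_real I (j + z))" by (rule swap[symmetric])
  finally have ge: "real n * (\<delta> * real (length zs)) \<le> (\<Sum>j\<in>{1..int n}. \<Sum>z\<leftarrow>zs. indicat_real I (j + z))" .
  show ?thesis
  proof (rule ccontr)
    assume "\<not> ?thesis"
    then have "(\<Sum>j\<in>{1..int n}. \<Sum>z\<leftarrow>zs. indicat_real I (j + z)) < (\<Sum>j\<in>{1..int n}. \<delta> * real (length zs))"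
      using n(2) by (intro sum_strict_mono) (auto simp: not_le)
    then show False using ge by simp
  qed
qed

text \<open>Division by \<open>c\<close> carries multiples of \<open>c\<close> to integers, which
  reduces the claim to the previous count.\<close>

lemma exists_dense_translate_multiples:
  fixes A :: "nat set" and gs :: "rat list"
  assumes "gs \<noteq> []" "\<delta> < \<delta>0" "0 < c"
    and dens: "\<And>n0. \<exists>n\<ge>n0. 0 < n \<and> \<delta>0 * real n < real (card (A \<inter> (\<lambda>j. c * j) ` {1..n}))"
    and div: "\<And>g. g \<in> set gs \<Longrightarrow> g / of_nat c \<in> \<int>"
  shows "\<exists>t. t / of_nat c \<in> \<int> \<and> \<delta> * real (length gs) \<le> (\<Sum>g\<leftarrow>gs. indicat_real (of_nat ` A) (t + g))"
proof -
  define I where "I = {i :: int. of_int i * of_nat c \<in> (of_nat ` A :: rat set)}"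
  have I: "of_nat (c * m) \<in> (of_nat ` A :: rat set) \<longleftrightarrow> c * m \<in> A" for m
    by (auto simp del: of_nat_mult)
  have card: "card (A \<inter> (\<lambda>j. c * j) ` {1..n}) = card (I \<inter> {1..int n})" for n
  proof -
    have "bij_betw (\<lambda>m. int (m div c)) (A \<inter> (\<lambda>j. c * j) ` {1..n}) (I \<inter> {1..int n})"
    proof (rule bij_betw_byWitness[where f' = "\<lambda>i. c * nat i"])
      show "\<forall>m\<in>A \<inter> (\<lambda>j. c * j) ` {1..n}. c * nat (int (m div c)) = m" using assms(3) by auto
      show "\<forall>i\<in>I \<inter> {1..int n}. int (c * nat i div c) = i" using assms(3) by auto
      show "(\<lambda>m. int (m div c)) ` (A \<inter> (\<lambda>j. c * j) ` {1..n}) \<subseteq> I \<inter> {1..int n}"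
        using assms(3) by (auto simp: I_def mult.commute simp flip: of_nat_mult)
      show "(\<lambda>i. c * nat i) ` (I \<inter> {1..int n}) \<subseteq> A \<inter> (\<lambda>j. c * j) ` {1..n}"
      proof (rule image_subsetI)
        fix i assume i: "i \<in> I \<inter> {1..int n}"
        then obtain m where m: "i = int m" by (metis IntD2 atLeastAtMost_iff nonneg_int_cases order_trans zero_le_one)
        have "of_nat (c * m) \<in> (of_nat ` A :: rat set)" using i m by (simp add: I_def mult.commute)
        then have "c * m \<in> A" using I by blast
        then show "c * nat i \<in> A \<inter> (\<lambda>j. c * j) ` {1..n}" using i m by auto
      qed
    qed
    then show ?thesis by (rule bij_betw_same_card)
  qed
  define zs where "zs = map (\<lambda>g. \<lfloor>g / of_nat c\<rfloor>) gs"
  have g: "g = of_int \<lfloor>g / of_nat c\<rfloor> * of_nat c" if "g \<in> set gs" for g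
    using div[OF that] assms(3) by (auto elim!: Ints_cases simp: field_simps)
  obtain j where j: "\<delta> * real (length zs) \<le> (\<Sum>z\<leftarrow>zs. indicat_real I (j + z))"
    using exists_dense_translate[of zs \<delta> \<delta>0 I] assms(1,2) dens unfolding card zs_def by auto
  have "indicat_real I (j + \<lfloor>g / of_nat c\<rfloor>) = indicat_real (of_nat ` A) (of_int j * of_nat c + g)"
    if "g \<in> set gs" for g
  proof -
    have "of_int (j + \<lfloor>g / of_nat c\<rfloor>) * of_nat c = of_int j * of_nat c + g"
      using g[OF that] by (simp add: distrib_right)
    then show ?thesis by (simp add: indicator_def I_def)
  qed
  then have "(\<Sum>z\<leftarrow>zs. indicat_real I (j + z)) = (\<Sum>g\<leftarrow>gs. indicat_real (of_nat ` A) (of_int j * of_nat c + g))"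
    unfolding zs_def by (simp add: comp_def cong: map_cong)
  then show ?thesis using j assms(3) by (intro exI[of _ "of_int j * of_nat c"]) (simp add: zs_def)
qed

section \<open>Diagonal choice of divisible sequences\<close>

lemma Ints_divide_dvd:
  fixes t :: "'a::field_char_0"
  assumes "t / of_nat m \<in> \<int>" "q dvd m" "0 < m"
  shows "t / of_nat q \<in> \<int>"
proof -
  obtain r where "m = q * r" using assms(2) by (rule dvdE)
  then have "t / of_nat q = of_nat r * (t / of_nat m)" using assms(3) by auto
  then show ?thesis using Ints_mult[OF Ints_of_nat assms(1)] by metis
qed

text \<open>At each \<open>N\<close> use a witness for the largest available \<open>q\<close>, which
  exists because \<open>q \<le> N\<close> is imposed. This \<open>q\<close> tends to infinity, so
  the chosen sequence is eventually divisible by every positive integer.\<close>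

lemma divseq_diagonal_choice:
  assumes P: "\<And>q. \<forall>\<^sub>F N in sequentially. \<exists>t. t / fact q \<in> \<int> \<and> P N t"
  shows "\<exists>h. \<forall>\<^sub>F N in sequentially. P N (seq h N)"
proof -
  define K where "K N = {q. q \<le> N \<and> (\<exists>t. t / fact q \<in> \<int> \<and> P N t)}" for N
  have fin: "finite (K N)" for N unfolding K_def by (rule finite_subset[of _ "{..N}"]) auto
  have "\<exists>t. K N \<noteq> {} \<longrightarrow> t / fact (Max (K N)) \<in> \<int> \<and> P N t" for N
    using Max_in[OF fin, of N] unfolding K_def by blast
  then obtain t where t: "\<And>N. K N \<noteq> {} \<Longrightarrow> t N / fact (Max (K N)) \<in> \<int> \<and> P N (t N)"
    by metis
  have inK: "\<forall>\<^sub>F N in sequentially. q \<in> K N" for q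
    using P[of q] eventually_ge_at_top[of q] by eventually_elim (auto simp: K_def)
  have "t N / of_nat q \<in> \<int>" if "0 < q" "q \<in> K N" for q N
  proof -
    have "q dvd fact (Max (K N))" using that fin by (intro dvd_fact Max_ge) auto
    moreover have "t N / of_nat (fact (Max (K N))) \<in> \<int>" using t[of N] that by auto
    ultimately show ?thesis using Ints_divide_dvd fact_gt_zero by blast
  qed
  then have "\<forall>\<^sub>F N in sequentially. t N / of_nat q \<in> \<int>" if "0 < q" for q
    using inK[of q] that by (auto elim: eventually_mono)
  then have "seq (Abs_divseq t) = t" by (intro Abs_divseq_inverse) auto
  \<comment> \<open>Eventually \<open>0\<close> is available, so \<open>K N\<close> is nonempty and
    \<open>t N\<close> is a genuine witness.\<close>
  moreover have "\<forall>\<^sub>F N in sequentially. P N (t N)"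
    using inK[of 0] by eventually_elim (use t in blast)
  ultimately show ?thesis by (metis (no_types))
qed

text \<open>Given \<open>q\<close>, take \<open>L \<ge> q\<close> with \<open>A\<close> dense on
  multiples of \<open>fact L\<close>. For large \<open>N\<close> all window terms are such
  multiples, so a good translate divisible by \<open>fact q\<close> exists; the diagonal choice
  assembles these into one group element.\<close>

lemma divseq_dense_translate:
  fixes A :: "nat set" and fs :: "divseq list"
  assumes "fs \<noteq> []" "\<delta> < \<delta>0"
    and dens: "\<And>L0. \<exists>L\<ge>L0. \<forall>n0. \<exists>n\<ge>n0. 0 < n \<and>
      \<delta>0 * real n < real (card (A \<inter> (\<lambda>j. fact L * j) ` {1..n}))"
  shows "\<exists>h. \<forall>\<^sub>F N in sequentially. \<delta> * real (length fs) \<le> (\<Sum>f\<leftarrow>fs. indicat_real (of_nat ` A) (seq (h + f) N))"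
proof -
  have "\<forall>\<^sub>F N in sequentially. \<exists>t. t / fact q \<in> \<int> \<and>
    \<delta> * real (length fs) \<le> (\<Sum>f\<leftarrow>fs. indicat_real (of_nat ` A) (t + seq f N))" for q
  proof -
    obtain L where L: "q \<le> L" and densL: "\<And>n0. \<exists>n\<ge>n0. 0 < n \<and>
      \<delta>0 * real n < real (card (A \<inter> (\<lambda>j. fact L * j) ` {1..n}))" using dens by blast
    have "\<forall>\<^sub>F N in sequentially. seq f N / of_nat (fact L) \<in> \<int>" for f
      using seq[of f] fact_gt_zero[of L] by blast
    then have "\<forall>\<^sub>F N in sequentially. \<forall>f\<in>set fs. seq f N / of_nat (fact L) \<in> \<int>"
      by (simp add: eventually_ball_finite_distrib)
    then show ?thesis
    proof eventually_elim
      case (elim N)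
      obtain t where t: "t / of_nat (fact L) \<in> \<int>" "\<delta> * real (length (map (\<lambda>f. seq f N) fs))
          \<le> (\<Sum>g\<leftarrow>map (\<lambda>f. seq f N) fs. indicat_real (of_nat ` A) (t + g))"
        using exists_dense_translate_multiples[of "map (\<lambda>f. seq f N) fs" \<delta> \<delta>0 "fact L" A]
          assms(1,2) densL elim by auto
      have "t / fact q \<in> \<int>" using Ints_divide_dvd[OF t(1) fact_dvd[OF L]] by simp
      then show ?case using t(2) by (intro exI[of _ t]) (simp add: comp_def)
    qed
  qed
  from divseq_diagonal_choice[of "\<lambda>N t. \<delta> * real (length fs) \<le> (\<Sum>f\<leftarrow>fs. indicat_real (of_nat ` A) (t + seq f N))", OF this]
  show ?thesis by (simp add: plus_divseq.rep_eq)
qed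

section \<open>Density of sum-free sets of integers\<close>

text \<open>A window count and a coincidence of two sums each involve finitely many group elements,
  so both can be compared with \<open>A\<close> at a single index \<open>N\<close>.\<close>

lemma sum_free_density_le:
  fixes A :: "nat set"
  assumes kl: "0 < k" "0 < l" and free: "sum_free k l A" and "\<delta> < \<delta>0"
    and dens: "\<And>L0. \<exists>L\<ge>L0. \<forall>n0. \<exists>n\<ge>n0. 0 < n \<and>
      \<delta>0 * real n < real (card (A \<inter> (\<lambda>j. fact L * j) ` {1..n}))"
  shows "\<delta> \<le> 1 / real (k + l)"
proof -
  obtain A' where A': "\<And>F N0. finite F \<Longrightarrow> \<exists>N\<ge>N0. \<forall>f\<in>F. f \<in> A' \<longleftrightarrow> f \<in> {f. seq f N \<in> of_nat ` A}"
    using cluster_set[of "\<lambda>N. {f. seq f N \<in> of_nat ` A}"] by blast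
  have "banach_density_ge \<delta> A'"
    unfolding banach_density_ge_def
  proof (intro allI impI)
    fix fs :: "divseq list" assume "fs \<noteq> []"
    from divseq_dense_translate[OF this \<open>\<delta> < \<delta>0\<close> dens] obtain h N0
      where h: "\<And>N. N0 \<le> N \<Longrightarrow> \<delta> * real (length fs) \<le> (\<Sum>f\<leftarrow>fs. indicat_real (of_nat ` A) (seq (h + f) N))"
      unfolding eventually_sequentially by blast
    obtain N where N: "N0 \<le> N" "\<And>f. f \<in> set fs \<Longrightarrow> h + f \<in> A' \<longleftrightarrow> seq (h + f) N \<in> of_nat ` A"
      using A'[of "(+) h ` set fs" N0] by auto
    have "(\<Sum>f\<leftarrow>fs. indicat_real (of_nat ` A) (seq (h + f) N)) = (\<Sum>f\<leftarrow>fs. indicat_real A' (h + f))"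
      using N(2) by (intro arg_cong[where f = sum_list] map_cong refl) (auto simp: indicator_def)
    then show "\<exists>h. \<delta> * real (length fs) \<le> (\<Sum>f\<leftarrow>fs. indicat_real A' (h + f))"
      using h[OF N(1)] by auto
  qed
  moreover have "sumset k A' \<inter> sumset l A' = {}"
  proof (rule equals0I)
    fix s assume "s \<in> sumset k A' \<inter> sumset l A'"
    then obtain x y where x: "s = (\<Sum>i<k. x i)" "\<And>i. i < k \<Longrightarrow> x i \<in> A'"
      and y: "s = (\<Sum>i<l. y i)" "\<And>i. i < l \<Longrightarrow> y i \<in> A'"
      unfolding sumset_def by blast
    obtain N where N: "\<And>f. f \<in> x ` {..<k} \<union> y ` {..<l} \<Longrightarrow> f \<in> A' \<longleftrightarrow> seq f N \<in> of_nat ` A"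
      using A'[of "x ` {..<k} \<union> y ` {..<l}" 0] by auto
    have "\<exists>a\<in>A. seq (x i) N = of_nat a" if "i < k" for i using N[of "x i"] x(2) that by auto
    then obtain a where a: "\<And>i. i < k \<Longrightarrow> a i \<in> A \<and> seq (x i) N = of_nat (a i)" by metis
    have "\<exists>a\<in>A. seq (y i) N = of_nat a" if "i < l" for i using N[of "y i"] y(2) that by auto
    then obtain b where b: "\<And>i. i < l \<Longrightarrow> b i \<in> A \<and> seq (y i) N = of_nat (b i)" by metis
    have "rat_of_nat (\<Sum>i<k. a i) = seq s N" using a by (simp add: x(1) seq_sum)
    moreover have "rat_of_nat (\<Sum>i<l. b i) = seq s N" using b by (simp add: y(1) seq_sum)
    ultimately have "(\<Sum>i<k. a i) = (\<Sum>i<l. b i)" by (metis of_nat_eq_iff)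
    then show False using free a b unfolding sum_free_def by blast
  qed
  ultimately show ?thesis using banach_density_sum_free[OF divseq_divisible] kl by blast
qed

theorem theorem6p1:
  fixes k l :: nat and A :: "nat set"
  assumes "0 < l" and "l < k"
    and "\<forall>a\<in>A. 0 < a"
    and "sum_free k l A"
  shows "upper_density_on_multiples A \<le> ereal (1 / real (k + l))"
proof (rule ccontr)
  assume "\<not> ?thesis"
  then obtain \<delta>0 where \<delta>0: "1 / real (k + l) < \<delta>0" "ereal \<delta>0 < upper_density_on_multiples A"
    using ereal_dense2[of "ereal (1 / real (k + l))" "upper_density_on_multiples A"] by (auto simp: not_le)
  define u where "u L n = ereal (real (card (A \<inter> (\<lambda>j. fact L * j) ` {1..n})) / real n)" for L n
  have ud: "upper_density_on_multiples A = limsup (\<lambda>L. limsup (u L))"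
    by (simp add: upper_density_on_multiples_def u_def[abs_def])
  have "\<exists>L\<ge>L0. \<forall>n0. \<exists>n\<ge>n0. 0 < n \<and> \<delta>0 * real n < real (card (A \<inter> (\<lambda>j. fact L * j) ` {1..n}))" for L0
  proof -
    have "\<not> (\<forall>\<^sub>F L in sequentially. limsup (u L) \<le> ereal \<delta>0)"
      using Limsup_bounded[of "\<lambda>L. limsup (u L)" "ereal \<delta>0" sequentially] \<delta>0(2)
      unfolding ud by (meson leD)
    then obtain L where L: "L0 \<le> L" "\<not> limsup (u L) \<le> ereal \<delta>0"
      unfolding eventually_sequentially by blast
    have "\<exists>n\<ge>n0. 0 < n \<and> \<delta>0 * real n < real (card (A \<inter> (\<lambda>j. fact L * j) ` {1..n}))" for n0
    proof -
      have "\<not> (\<forall>\<^sub>F n in sequentially. u L n \<le> ereal \<delta>0)"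
        using Limsup_bounded[of "u L" "ereal \<delta>0" sequentially] L(2) by auto
      \<comment> \<open>\<open>Suc n0\<close> keeps \<open>n\<close> positive, so the quotient is a
        genuine one.\<close>
      then obtain n where n: "Suc n0 \<le> n" "\<not> u L n \<le> ereal \<delta>0"
        unfolding eventually_sequentially by blast
      then show ?thesis by (intro exI[of _ n]) (auto simp: u_def field_simps)
    qed
    with L(1) show ?thesis by blast
  qed
  \<comment> \<open>The gap below \<delta>0 pays for the boundary losses of translated
    windows.\<close>
  moreover obtain \<delta> where "1 / real (k + l) < \<delta>" "\<delta> < \<delta>0" using \<delta>0(1) dense by blast
  ultimately show False using sum_free_density_le[of k l A \<delta> \<delta>0] assms by auto
qed

end
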